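(* Let $1\le k\le n$ and $\sigma\in S^k_n$. There is a smooth $(k+1)$-dimensional foliation refining the cell $\mathcal{M}_{k,\sigma}$ into disjoint leaves $\mathcal{M}^C_{k,\sigma}$ parameterized by $C\in\mathbb{S}^{k-1,\sigma}_{>0}$; that is, $\mathcal{M}_{k,\sigma}=\bigsqcup_{C\in\mathbb{S}^{k-1,\sigma}_{>0}}\mathcal{M}^C_{k,\sigma}$. Each leaf $\mathcal{M}^C_{k,\sigma}$ is a flow-invariant manifold homeomorphic to $\mathbb{T}_k\times\mathbb{R}^+$, and $\mathcal{M}_{k,\sigma}$ is homeomorphic to $\mathbb{T}_k\times\mathbb{R}^+\times\mathbb{S}^{k-1}_{>0}$. The set $\mathcal{M}^C_{k,\sigma}$ is a minimal manifold that is invariant under all flows associated with Eulerian and rotational vector fields.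
   Context: Points of $\mathbb{R}^{2n}$ are $\mathbf{x}=(x_1,y_1,\dots,x_n,y_n)$; $\mathbb{R}^+=(0,\infty)$; $\mathbb{T}_k$ is a $k$-dimensional (Clifford) torus. $S^k_n$ is the set of permutations $\sigma$ of $\{1,\dots,n\}$ with $\sigma(i)<\sigma(j)$ for $i<j\le k$ and for $k<i<j\le n$. $\mathcal{M}_{k,\sigma}=\{\mathbf{x}\in\mathbb{R}^{2n}:(x_{\sigma(i)},y_{\sigma(i)})\ne 0 \text{ for } i\le k,\ (x_{\sigma(i)},y_{\sigma(i)})=0\text{ for } i>k\}$. $\mathbb{S}^{k-1}_{>0}$ is the set of unit vectors in $\mathbb{R}^k$ with all entries positive, and $\mathbb{S}^{k-1,\sigma}_{>0}=\{(c_1,\dots,c_n)\in\mathbb{R}^n:\ \sum_{i\le k}c_{\sigma(i)}^2=1,\ c_{\sigma(i)}>0\text{ for } i\le k,\ c_{\sigma(i)}=0\text{ for } i>k\}$. The leaf is $$\mathcal{M}^C_{k,\sigma}=\{\mathbf{x}\in\mathcal{M}_{k,\sigma}:\ c_{\sigma(j)}\|(x_{\sigma(i)},y_{\sigma(i)})\|=c_{\sigma(i)}\|(x_{\sigma(j)},y_{\sigma(j)})\|,\ 1\le i,j\le k\}.$$ Eulerian vector fields are $gE_{\mathbf 0}$ with $E_{\mathbf 0}=\sum_{i}(x_i\partial_{x_i}+y_i\partial_{y_i})$, and rotational vector fields are $f\,\Theta^i_{\mathbf 0}$ with $\Theta^i_{\mathbf 0}=-y_i\partial_{x_i}+x_i\partial_{y_i}$,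 where $f,g\in\mathbb{R}[[\mathbf{x}]]$. Flow-invariant means invariant under the flow of every vector field $\sum_i\omega_i\Theta^i_{\mathbf 0}+\sum_i f_i\Theta^i_{\mathbf 0}+gE_{\mathbf 0}$ with $f_i(0)=g(0)=0$, $\prod_i\omega_i\ne0$, $\omega_i/\omega_j\notin\mathbb{Q}$ for $i<j$. A minimal invariant manifold is an integral leaf of the foliation associated with all Eulerian and rotational vector fields, i.e. an invariant integral manifold whose tangent bundle is spanned by these vector fields. *)

theory Defs
  imports "HOL-Analysis.Analysis" "HOL-Combinatorics.Permutations"
begin

section \<open>Smooth maps, submanifolds and foliations\<close>

primrec Ck_on :: "nat \<Rightarrow> 'a::euclidean_space set \<Rightarrow> ('a \<Rightarrow> 'b::real_normed_vector) \<Rightarrow> bool" where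
  "Ck_on 0 S f \<longleftrightarrow> continuous_on S f"
| "Ck_on (Suc m) S f \<longleftrightarrow>
     (\<forall>x\<in>S. f differentiable (at x)) \<and> (\<forall>v. Ck_on m S (\<lambda>x. frechet_derivative f (at x) v))"

text \<open>Only meant for open \<^term>\<open>S\<close>.\<close>

definition smooth_on :: "'a::euclidean_space set \<Rightarrow> ('a \<Rightarrow> 'b::real_normed_vector) \<Rightarrow> bool" where
  "smooth_on S f \<longleftrightarrow> (\<forall>m. Ck_on m S f)"

definition diffeomorphism :: "'a::euclidean_space set \<Rightarrow> 'a set \<Rightarrow> ('a \<Rightarrow> 'a) \<Rightarrow> bool" where
  "diffeomorphism U V \<phi> \<longleftrightarrow>
     open U \<and> open V \<and> bij_betw \<phi> U V \<and> smooth_on U \<phi> \<and> smooth_on V (inv_into U \<phi>)"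

text \<open>Embedded submanifolds of a Euclidean space, by slice charts.\<close>

definition smooth_submanifold :: "nat \<Rightarrow> 'a::euclidean_space set \<Rightarrow> bool" where
  "smooth_submanifold d M \<longleftrightarrow>
     (\<forall>q\<in>M. \<exists>U V \<phi> T. q \<in> U \<and> diffeomorphism U V \<phi> \<and>
        subspace T \<and> dim T = d \<and> \<phi> ` (U \<inter> M) = V \<inter> T)"

text \<open>
  A \<open>p\<close>-dimensional smooth foliation of the embedded submanifold \<open>M\<close> with set of leaves \<open>\<F>\<close>:
  the leaves are nonempty, pairwise disjoint and cover \<open>M\<close>, and every point of \<open>M\<close> has a flat
  chart, in which each leaf is a countable union of plaques, i.e. of parallel \<open>p\<close>-dimensional
  affine slices (\<^term>\<open>convex V\<close> makes the plaques connected). The leaves have to be connected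
  in their leaf topology. This is the same as path-connectedness as a subset of \<open>M\<close>:
  along a path inside a leaf the transversal coordinate takes countably many values in each
  flat chart, hence is locally constant.
\<close>

definition smooth_foliation :: "nat \<Rightarrow> 'a::euclidean_space set \<Rightarrow> 'a set set \<Rightarrow> bool" where
  "smooth_foliation p M \<F> \<longleftrightarrow>
     \<Union>\<F> = M \<and> disjoint \<F> \<and> (\<forall>L\<in>\<F>. L \<noteq> {} \<and> path_connected L) \<and>
     (\<exists>d. \<forall>q\<in>M. \<exists>U V \<phi> T F. q \<in> U \<and> diffeomorphism U V \<phi> \<and> convex V \<and>
        subspace T \<and> dim T = d \<and> subspace F \<and> dim F = p \<and> F \<subseteq> T \<and>
        \<phi> ` (U \<inter> M) = V \<inter> T \<and>
        (\<forall>L\<in>\<F>. \<exists>A. countable A \<and> \<phi> ` (U \<inter> L) = (\<Union>a\<in>A. {v \<in> V. v - a \<in> F})))"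

definition tangent_space :: "'a::euclidean_space set \<Rightarrow> 'a \<Rightarrow> 'a set" where
  "tangent_space M x =
     {v. \<exists>\<gamma> \<epsilon>::real. \<epsilon> > 0 \<and> smooth_on {-\<epsilon><..<\<epsilon>} \<gamma> \<and> \<gamma> ` {-\<epsilon><..<\<epsilon>} \<subseteq> M \<and>
        \<gamma> 0 = x \<and> (\<gamma> has_vector_derivative v) (at 0)}"

section \<open>Flows\<close>

definition integral_curve ::
  "('a::euclidean_space \<Rightarrow> 'a) \<Rightarrow> 'a set \<Rightarrow> real set \<Rightarrow> (real \<Rightarrow> 'a) \<Rightarrow> bool" where
  "integral_curve X \<Omega> I \<gamma> \<longleftrightarrow>
     is_interval I \<and> (\<forall>t\<in>I. \<gamma> t \<in> \<Omega> \<and> (\<gamma> has_vector_derivative X (\<gamma> t)) (at t within I))"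

text \<open>
  Invariance under the (local, forward and backward) flow of the vector field \<open>X\<close> on \<open>\<Omega>\<close>.
\<close>

definition invariant_under :: "('a::euclidean_space \<Rightarrow> 'a) \<Rightarrow> 'a set \<Rightarrow> 'a set \<Rightarrow> bool" where
  "invariant_under X \<Omega> S \<longleftrightarrow>
     (\<forall>I \<gamma> t0. integral_curve X \<Omega> I \<gamma> \<and> t0 \<in> I \<and> \<gamma> t0 \<in> S \<longrightarrow> \<gamma> ` I \<subseteq> S)"

section \<open>Eulerian and rotational vector fields\<close>

text \<open>
  A point of \<open>\<real>\<^sup>2\<^sup>n\<close> is an element of \<^typ>\<open>(real \<times> real) ^ 'n\<close>, where \<open>n = CARD('n)\<close>. The parameter
  \<open>e\<close> below numbers the coordinate pairs: it is a bijection from \<open>{1..n}\<close> onto \<open>'n\<close>, and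
  \<open>(x\<^sub>i, y\<^sub>i)\<close> is \<open>x $ e i\<close>.

  A coefficient in \<open>\<real>[[x]]\<close> is represented by a smooth function on an open neighbourhood \<open>\<Omega>\<close> of the
  origin. By Borel's theorem the Taylor series of these functions are exactly the formal power
  series, and convergent series on their domain of convergence are included.
\<close>

definition E0 :: "(real \<times> real) ^ 'n::finite \<Rightarrow> (real \<times> real) ^ 'n" where
  "E0 x = (\<chi> j. (fst (x $ j), snd (x $ j)))"

definition Theta0 :: "(nat \<Rightarrow> 'n::finite) \<Rightarrow> nat \<Rightarrow> (real \<times> real) ^ 'n \<Rightarrow> (real \<times> real) ^ 'n" where
  "Theta0 e i x = axis (e i) (- snd (x $ e i), fst (x $ e i))"

definition eulerian_field ::
  "((real \<times> real) ^ 'n::finite) set \<Rightarrow> ((real \<times> real) ^ 'n \<Rightarrow> (real \<times> real) ^ 'n) \<Rightarrow> bool" where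
  "eulerian_field \<Omega> X \<longleftrightarrow>
     open \<Omega> \<and> 0 \<in> \<Omega> \<and> (\<exists>g::_ \<Rightarrow> real. smooth_on \<Omega> g \<and> X = (\<lambda>x. g x *\<^sub>R E0 x))"

definition rotational_field ::
  "(nat \<Rightarrow> 'n::finite) \<Rightarrow> ((real \<times> real) ^ 'n) set \<Rightarrow>
     ((real \<times> real) ^ 'n \<Rightarrow> (real \<times> real) ^ 'n) \<Rightarrow> bool" where
  "rotational_field e \<Omega> X \<longleftrightarrow>
     open \<Omega> \<and> 0 \<in> \<Omega> \<and>
     (\<exists>i\<in>{1..CARD('n)}. \<exists>f::_ \<Rightarrow> real. smooth_on \<Omega> f \<and> X = (\<lambda>x. f x *\<^sub>R Theta0 e i x))"

definition flow_invariant :: "(nat \<Rightarrow> 'n::finite) \<Rightarrow> ((real \<times> real) ^ 'n) set \<Rightarrow> bool" where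
  "flow_invariant e S \<longleftrightarrow>
     (\<forall>\<Omega> (\<omega>::nat \<Rightarrow> real) (f::nat \<Rightarrow> _ \<Rightarrow> real) (g::_ \<Rightarrow> real).
        open \<Omega> \<and> 0 \<in> \<Omega> \<and>
        (\<forall>i\<in>{1..CARD('n)}. smooth_on \<Omega> (f i) \<and> f i 0 = 0) \<and>
        smooth_on \<Omega> g \<and> g 0 = 0 \<and>
        (\<Prod>i=1..CARD('n). \<omega> i) \<noteq> 0 \<and>
        (\<forall>i j. 1 \<le> i \<and> i < j \<and> j \<le> CARD('n) \<longrightarrow> \<omega> i / \<omega> j \<notin> \<rat>) \<longrightarrow>
        invariant_under
          (\<lambda>x. (\<Sum>i=1..CARD('n). \<omega> i *\<^sub>R Theta0 e i x)
             + (\<Sum>i=1..CARD('n). f i x *\<^sub>R Theta0 e i x) + g x *\<^sub>R E0 x) \<Omega> S)"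

definition ER_distribution ::
  "(nat \<Rightarrow> 'n::finite) \<Rightarrow> (real \<times> real) ^ 'n \<Rightarrow> ((real \<times> real) ^ 'n) set" where
  "ER_distribution e x =
     span {X x |X \<Omega>. x \<in> \<Omega> \<and> (eulerian_field \<Omega> X \<or> rotational_field e \<Omega> X)}"

definition integral_manifold :: "(nat \<Rightarrow> 'n::finite) \<Rightarrow> ((real \<times> real) ^ 'n) set \<Rightarrow> bool" where
  "integral_manifold e N \<longleftrightarrow>
     N \<noteq> {} \<and> connected N \<and> (\<exists>d. smooth_submanifold d N) \<and>
     (\<forall>x\<in>N. tangent_space N x = ER_distribution e x)"

text \<open>An integral leaf is a maximal connected integral manifold.\<close>

definition minimal_invariant_manifold ::
  "(nat \<Rightarrow> 'n::finite) \<Rightarrow> ((real \<times> real) ^ 'n) set \<Rightarrow> bool" where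
  "minimal_invariant_manifold e L \<longleftrightarrow>
     integral_manifold e L \<and>
     (\<forall>N. integral_manifold e N \<and> L \<subseteq> N \<longrightarrow> N = L) \<and>
     (\<forall>\<Omega> X. eulerian_field \<Omega> X \<or> rotational_field e \<Omega> X \<longrightarrow> invariant_under X \<Omega> L)"

section \<open>Cells and leaves\<close>

definition shuffle_perms :: "nat \<Rightarrow> nat \<Rightarrow> (nat \<Rightarrow> nat) set" where
  "shuffle_perms k n =
     {\<sigma>. \<sigma> permutes {1..n} \<and>
        (\<forall>i j. 1 \<le> i \<and> i < j \<and> j \<le> k \<longrightarrow> \<sigma> i < \<sigma> j) \<and>
        (\<forall>i j. k < i \<and> i < j \<and> j \<le> n \<longrightarrow> \<sigma> i < \<sigma> j)}"

definition cell ::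
  "(nat \<Rightarrow> 'n::finite) \<Rightarrow> nat \<Rightarrow> (nat \<Rightarrow> nat) \<Rightarrow> ((real \<times> real) ^ 'n) set" where
  "cell e k \<sigma> =
     {x. (\<forall>i\<in>{1..k}. x $ e (\<sigma> i) \<noteq> (0, 0)) \<and> (\<forall>i\<in>{k<..CARD('n)}. x $ e (\<sigma> i) = (0, 0))}"

definition leaf_params ::
  "(nat \<Rightarrow> 'n::finite) \<Rightarrow> nat \<Rightarrow> (nat \<Rightarrow> nat) \<Rightarrow> (real ^ 'n) set" where
  "leaf_params e k \<sigma> =
     {C. (\<Sum>i=1..k. (C $ e (\<sigma> i))\<^sup>2) = 1 \<and>
         (\<forall>i\<in>{1..k}. C $ e (\<sigma> i) > 0) \<and> (\<forall>i\<in>{k<..CARD('n)}. C $ e (\<sigma> i) = 0)}"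

definition leaf ::
  "(nat \<Rightarrow> 'n::finite) \<Rightarrow> nat \<Rightarrow> (nat \<Rightarrow> nat) \<Rightarrow> real ^ 'n \<Rightarrow> ((real \<times> real) ^ 'n) set" where
  "leaf e k \<sigma> C =
     {x \<in> cell e k \<sigma>. \<forall>i\<in>{1..k}. \<forall>j\<in>{1..k}.
        C $ e (\<sigma> j) * norm (x $ e (\<sigma> i)) = C $ e (\<sigma> i) * norm (x $ e (\<sigma> j))}"

text \<open>The \<open>k\<close>-torus as a product of \<open>k\<close> unit circles in \<open>\<real>\<^sup>2\<close>.\<close>

definition torus :: "nat \<Rightarrow> (nat \<Rightarrow> real \<times> real) topology" where
  "torus k = product_topology (\<lambda>_. top_of_set (sphere (0, 0) 1)) {1..k}"

text \<open>\<open>\<real>\<^sup>k\<close> is \<^term>\<open>powertop_real {1..k}\<close>, since here \<open>k\<close> is not the cardinality of a type.\<close>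

definition positive_sphere :: "nat \<Rightarrow> (nat \<Rightarrow> real) topology" where
  "positive_sphere k =
     subtopology (powertop_real {1..k}) {c. (\<Sum>i=1..k. (c i)\<^sup>2) = 1 \<and> (\<forall>i\<in>{1..k}. c i > 0)}"

end

theory Submission
  imports Defs
begin

text \<open>
  The proof rests on one map. The \<^emph>\<open>shape\<close> of a point \<open>x \<noteq> 0\<close> is the vector of its radii \<open>norm (x $ j)\<close>
  divided by \<open>norm x\<close>. With \<open>J\<close> the set of coordinate pairs that do not vanish on the cell, the
  parameters of the leaves are exactly the shapes of the points of the cell, and the leaf of
  parameter \<open>C\<close> is the fibre of the shape over \<open>C\<close> (\<open>leaf_params_eq\<close>, \<open>leaf_eq\<close>). In particular the
  leaves are disjoint and cover the cell. Two points lie on the same leaf if and only if their radii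
  differ by one common positive factor.

  \<^emph>\<open>Foliation.\<close> Near a point \<open>q\<close>, replace each nonvanishing pair by the logarithm of its squared
  radius and the tangent of its angle relative to \<open>q\<close>. A common factor of the radii becomes a common
  translation of the logarithms, so the leaves become translates of one linear space, spanned by the
  common radial direction and the \<open>k\<close> angular directions (\<open>flat_chart_leaf\<close>, \<open>dim_plaque_dir\<close>).

  \<^emph>\<open>Invariance.\<close> Along the vector fields in question, all squared radii satisfy the same scalar linear
  differential equation \<open>s' = 2 g s\<close>, where \<open>g\<close> is the coefficient of the Euler field, because the
  rotations are orthogonal to the radial directions. So all radii are multiplied by a common factor
  (\<open>invariant_under_shape_fibre\<close>).

  \<^emph>\<open>Minimality.\<close> Differentiating the equations of a leaf shows that its tangent spaces are contained
  in the Euler-rotation distribution, and the dimensions agree (\<open>tangent_space_shape_fibre\<close>).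
  Conversely, the functions \<open>(norm (x $ j) / norm x)\<^sup>2\<close> have derivative zero on the distribution, hence
  are constant on connected integral manifolds that avoid the origin, and no integral manifold of positive
  dimension contains the origin (\<open>integral_manifold_shape_constant\<close>). So leaves are maximal.

  \<^emph>\<open>Topology.\<close> A point of the cell is determined by the directions of its nonvanishing pairs, its norm
  and its shape, and these can be prescribed independently (\<open>homeomorphic_support_cell\<close>); on a leaf
  the shape is fixed (\<open>homeomorphic_shape_fibre\<close>).
\<close>

section \<open>Calculus of smooth maps\<close>

lemma Ck_on_cong:
  assumes "open S" "\<And>x. x \<in> S \<Longrightarrow> f x = g x" "Ck_on m S f"
  shows "Ck_on m S g"
  using assms(2,3)
proof (induction m arbitrary: f g)
  case 0
  then show ?case by (simp cong: continuous_on_cong)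
next
  case (Suc m)
  have d: "(g has_derivative frechet_derivative f (at x)) (at x)" if "x \<in> S" for x
    using Suc.prems that has_derivative_transform_within_open[OF _ assms(1) that, of f _ UNIV g]
    by (auto simp: frechet_derivative_works)
  then have "frechet_derivative f (at x) = frechet_derivative g (at x)" if "x \<in> S" for x
    using frechet_derivative_at that by blast
  with Suc.IH[of "\<lambda>x. frechet_derivative f (at x) v" "\<lambda>x. frechet_derivative g (at x) v" for v]
  show ?case using Suc.prems(2) d by (auto simp: differentiable_def)
qed

text \<open>
Any pointwise formula for the derivative may be used to establish differentiability of order
\<open>Suc m\<close>: the Frechet derivative agrees with it on the open set, and only its values there matter.
\<close>

lemma Ck_on_SucI:
  assumes "open S" "\<And>x. x \<in> S \<Longrightarrow> (f has_derivative f' x) (at x)" "\<And>v. Ck_on m S (\<lambda>x. f' x v)"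
  shows "Ck_on (Suc m) S f"
proof -
  have eq: "f' x = frechet_derivative f (at x)" if "x \<in> S" for x
    using assms(2)[OF that] frechet_derivative_at by metis
  have "Ck_on m S (\<lambda>x. frechet_derivative f (at x) v)" for v
    using Ck_on_cong[OF assms(1) _ assms(3)[of v]] eq by simp
  then show ?thesis
    using assms(2) by (auto simp: differentiable_def)
qed

lemma Ck_on_SucD: "Ck_on (Suc m) S f \<Longrightarrow> Ck_on m S f"
proof (induction m arbitrary: f)
  case 0
  then show ?case
    by (simp add: continuous_at_imp_continuous_on differentiable_imp_continuous_within)
next
  case (Suc m)
  then show ?case by (metis Ck_on.simps(2))
qed

lemma Ck_on_has_derivative:
  "Ck_on (Suc m) S f \<Longrightarrow> x \<in> S \<Longrightarrow> (f has_derivative frechet_derivative f (at x)) (at x)"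
  by (simp add: frechet_derivative_works)

lemma Ck_on_const: "open S \<Longrightarrow> Ck_on m S (\<lambda>_. c)"
  by (induction m arbitrary: c) (auto simp: frechet_derivative_const)

lemma Ck_on_add:
  assumes "open S" "Ck_on m S f" "Ck_on m S g"
  shows "Ck_on m S (\<lambda>x. f x + g x)"
  using assms(2,3)
proof (induction m arbitrary: f g)
  case (Suc m)
  show ?case
    by (rule Ck_on_SucI[OF assms(1) has_derivative_add[OF Ck_on_has_derivative Ck_on_has_derivative]])
      (use Suc in auto)
qed (auto intro: continuous_on_add)

lemma Ck_on_sum:
  assumes "open S" "\<And>i. i \<in> I \<Longrightarrow> Ck_on m S (f i)"
  shows "Ck_on m S (\<lambda>x. \<Sum>i\<in>I. f i x)"
  using assms(2)
  by (induction I rule: infinite_finite_induct) (auto simp: assms(1) Ck_on_const Ck_on_add)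

lemma Ck_on_linear:
  assumes "open S" "bounded_linear L" "Ck_on m S f"
  shows "Ck_on m S (\<lambda>x. L (f x))"
  using assms(3)
proof (induction m arbitrary: f)
  case 0
  then show ?case using bounded_linear.continuous_on[OF assms(2)] by auto
next
  case (Suc m)
  show ?case
    by (rule Ck_on_SucI[OF assms(1) bounded_linear.has_derivative[OF assms(2) Ck_on_has_derivative]])
      (use Suc in auto)
qed

text \<open>
The product rule writes the derivative as a sum of two bilinear expressions in functions that are
still of class \<open>m\<close>, so the induction is on the order with both factors arbitrary.
\<close>

lemma Ck_on_bilinear:
  assumes "open S" "bounded_bilinear B" "Ck_on m S f" "Ck_on m S g"
  shows "Ck_on m S (\<lambda>x. B (f x) (g x))"
  using assms(3,4)
proof (induction m arbitrary: f g)
  case 0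
  then show ?case using bounded_bilinear.continuous_on[OF assms(2)] by auto
next
  case (Suc m)
  show ?case
  proof (rule Ck_on_SucI[OF assms(1)])
    fix x assume "x \<in> S"
    then show "((\<lambda>x. B (f x) (g x)) has_derivative
        (\<lambda>v. B (f x) (frechet_derivative g (at x) v) + B (frechet_derivative f (at x) v) (g x))) (at x)"
      using Suc.prems by (intro bounded_bilinear.FDERIV[OF assms(2)] Ck_on_has_derivative) auto
  next
    fix v
    show "Ck_on m S (\<lambda>x. B (f x) (frechet_derivative g (at x) v) + B (frechet_derivative f (at x) v) (g x))"
      using Suc.prems Ck_on_SucD[of m S f] Ck_on_SucD[of m S g]
      by (intro Ck_on_add[OF assms(1)] Suc.IH) auto
  qed
qed

text \<open>
By the chain rule, the derivative of \<open>g \<circ> f\<close> in direction \<open>v\<close> is \<open>Dg (f x) (Df x v)\<close>, which has two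
occurrences of \<open>x\<close>. Expanding the inner vector in the standard basis turns it into a sum of products
of a coordinate of \<open>Df x v\<close> with a partial derivative of \<open>g\<close> composed with \<open>f\<close>; the induction
hypothesis applies to the latter.
\<close>

lemma Ck_on_compose:
  fixes f :: "'a::euclidean_space \<Rightarrow> 'b::euclidean_space" and g :: "'b \<Rightarrow> 'c::real_normed_vector"
  assumes "open S" "open T" "f ` S \<subseteq> T" "Ck_on m S f" "Ck_on m T g"
  shows "Ck_on m S (\<lambda>x. g (f x))"
  using assms(4,5)
proof (induction m arbitrary: g)
  case 0
  then show ?case using assms(3) continuous_on_compose2[of T g S f] by auto
next
  case (Suc m)
  show ?case
  proof (rule Ck_on_SucI[OF assms(1)])
    fix x assume "x \<in> S"
    then show "((\<lambda>x. g (f x)) has_derivative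
        (\<lambda>v. frechet_derivative g (at (f x)) (frechet_derivative f (at x) v))) (at x)"
      using Suc.prems assms(3)
      by (intro has_derivative_compose[OF Ck_on_has_derivative Ck_on_has_derivative]) auto
  next
    fix v
    let ?w = "\<lambda>x. frechet_derivative f (at x) v"
    have "Ck_on m S (\<lambda>x. \<Sum>b\<in>Basis. (?w x \<bullet> b) *\<^sub>R frechet_derivative g (at (f x)) b)"
      using Suc.prems Ck_on_SucD[of m S f]
      by (intro Ck_on_sum[OF assms(1)] Ck_on_bilinear[OF assms(1) bounded_bilinear_scaleR]
          Ck_on_linear[OF assms(1) bounded_linear_inner_left] Suc.IH) auto
    then show "Ck_on m S (\<lambda>x. frechet_derivative g (at (f x)) (?w x))"
    proof (rule Ck_on_cong[OF assms(1), rotated])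
      fix x assume "x \<in> S"
      then interpret bounded_linear "frechet_derivative g (at (f x))"
        using Suc.prems assms(3) Ck_on_has_derivative has_derivative_bounded_linear by blast
      show "(\<Sum>b\<in>Basis. (?w x \<bullet> b) *\<^sub>R frechet_derivative g (at (f x)) b) =
          frechet_derivative g (at (f x)) (?w x)"
        by (subst (2) euclidean_representation[symmetric]) (simp only: sum scaleR)
    qed
  qed
qed

lemma Ck_on_vec:
  fixes f :: "'a::euclidean_space \<Rightarrow> 'b::euclidean_space ^ 'n"
  assumes "open S" "\<And>i. Ck_on m S (\<lambda>x. f x $ i)"
  shows "Ck_on m S f"
proof -
  have b: "bounded_linear (axis i :: 'b \<Rightarrow> 'b ^ 'n)" for i
    by (intro linear_conv_bounded_linear[THEN iffD1] linearI) (auto simp: vec_eq_iff axis_def)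
  have "Ck_on m S (\<lambda>x. \<Sum>i\<in>UNIV. axis i (f x $ i))"
    by (intro Ck_on_sum Ck_on_linear[OF _ b] assms)
  moreover have "(\<Sum>i\<in>UNIV. axis i (f x $ i)) = f x" for x
    by (simp add: vec_eq_iff axis_def if_distrib cong: if_cong)
  ultimately show ?thesis by simp
qed

lemma Ck_on_Pair:
  assumes "open S" "Ck_on m S f" "Ck_on m S g"
  shows "Ck_on m S (\<lambda>x. (f x, g x))"
  using Ck_on_add[OF assms(1) Ck_on_linear[OF assms(1) _ assms(2), of "\<lambda>a. (a, 0)"]
      Ck_on_linear[OF assms(1) _ assms(3), of "\<lambda>a. (0, a)"]]
  by (simp add: bounded_linear_Pair bounded_linear_ident bounded_linear_zero)

lemma Ck_on_id: "open S \<Longrightarrow> Ck_on m S (\<lambda>x. x)"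
proof (cases m)
  case (Suc k)
  assume "open S"
  then show ?thesis unfolding Suc
    by (intro Ck_on_SucI[OF _ has_derivative_ident] Ck_on_const)
qed simp

lemma Ck_on_inverse: "Ck_on m {0<..} (inverse :: real \<Rightarrow> real)"
proof (induction m)
  case (Suc m)
  show ?case
  proof (rule Ck_on_SucI)
    show "(inverse has_derivative (\<lambda>v. - (inverse x * v * inverse x))) (at x)"
      if "x \<in> {0<..}" for x :: real
      using that by (intro has_derivative_inverse') auto
    show "Ck_on m {0<..} (\<lambda>x. - (inverse x * v * inverse x))" for v :: real
      by (intro Ck_on_linear[OF _ bounded_linear_minus[OF bounded_linear_ident]]
        Ck_on_bilinear[OF _ bounded_bilinear_mult] Suc Ck_on_const open_greaterThan)
  qed simp
next
  case 0
  show ?case by (auto intro!: continuous_on_inverse continuous_on_id)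
qed

lemma Ck_on_ln: "Ck_on m {0<..} (ln :: real \<Rightarrow> real)"
proof (cases m)
  case (Suc k)
  show ?thesis unfolding Suc
  proof (rule Ck_on_SucI)
    show "(ln has_derivative (\<lambda>v. v * inverse x)) (at x)" if "x \<in> {0<..}" for x :: real
      using that by (auto intro!: derivative_eq_intros)
    show "Ck_on k {0<..} (\<lambda>x. v * inverse x)" for v :: real
      by (intro Ck_on_bilinear[OF _ bounded_bilinear_mult] Ck_on_const Ck_on_inverse open_greaterThan)
  qed simp
next
  case 0
  then show ?thesis by (auto intro: continuous_on_ln continuous_on_id)
qed

lemma Ck_on_exp: "Ck_on m UNIV (exp :: real \<Rightarrow> real)"
proof (induction m)
  case (Suc m)
  show ?case
  proof (rule Ck_on_SucI)
    show "(exp has_derivative (\<lambda>v. v * exp x)) (at x)" for x :: real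
      by (auto intro!: derivative_eq_intros)
    show "Ck_on m UNIV (\<lambda>x. v * exp x)" for v :: real
      by (intro Ck_on_bilinear[OF _ bounded_bilinear_mult] Ck_on_const Suc open_UNIV)
  qed simp
qed (simp add: continuous_on_exp continuous_on_id)

section \<open>Tangent spaces of submanifolds\<close>

lemma smooth_on_has_derivative:
  "smooth_on U f \<Longrightarrow> x \<in> U \<Longrightarrow> (f has_derivative frechet_derivative f (at x)) (at x)"
  unfolding smooth_on_def using Ck_on_has_derivative by blast

lemma smooth_on_const: "open S \<Longrightarrow> smooth_on S (\<lambda>_. c)"
  by (simp add: smooth_on_def Ck_on_const)

lemma smooth_on_compose:
  fixes f :: "'a::euclidean_space \<Rightarrow> 'b::euclidean_space"
  assumes "open S" "open T" "f ` S \<subseteq> T" "smooth_on S f" "smooth_on T g"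
  shows "smooth_on S (\<lambda>x. g (f x))"
  using assms Ck_on_compose unfolding smooth_on_def by blast

lemma smooth_on_continuous_on: "smooth_on U f \<Longrightarrow> continuous_on U f"
  unfolding smooth_on_def by (metis Ck_on.simps(1))

lemma diffeomorphism_inverse:
  assumes "diffeomorphism U V \<phi>"
  shows "x \<in> U \<Longrightarrow> \<phi> x \<in> V" "x \<in> U \<Longrightarrow> inv_into U \<phi> (\<phi> x) = x"
    "y \<in> V \<Longrightarrow> inv_into U \<phi> y \<in> U" "y \<in> V \<Longrightarrow> \<phi> (inv_into U \<phi> y) = y"
  using assms unfolding diffeomorphism_def
  by (auto dest: bij_betwE bij_betw_inv_into_left bij_betw_inv_into_right bij_betw_inv_into)

lemma diffeomorphism_derivatives_inverse:
  assumes "diffeomorphism U V \<phi>" "x \<in> U"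
  defines "A \<equiv> frechet_derivative \<phi> (at x)" and "B \<equiv> frechet_derivative (inv_into U \<phi>) (at (\<phi> x))"
  shows "A (B v) = v" "B (A v) = v"
proof -
  note i = diffeomorphism_inverse[OF assms(1)]
  have U: "open U" "open V" and A: "(\<phi> has_derivative A) (at x)"
    and B: "(inv_into U \<phi> has_derivative B) (at (\<phi> x))"
    using assms i unfolding diffeomorphism_def A_def B_def
    by (auto intro: smooth_on_has_derivative)
  have "((\<lambda>x. inv_into U \<phi> (\<phi> x)) has_derivative (\<lambda>v. B (A v))) (at x)"
    using has_derivative_compose[OF A B] by simp
  then have "((\<lambda>x. x) has_derivative (\<lambda>v. B (A v))) (at x)"
    by (rule has_derivative_transform_within_open[OF _ U(1) assms(2)]) (simp add: i)
  then have "(\<lambda>v. B (A v)) = (\<lambda>v. v)"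
    by (rule has_derivative_unique[OF _ has_derivative_ident])
  then show "B (A v) = v" by metis
  have "((\<lambda>y. \<phi> (inv_into U \<phi> y)) has_derivative (\<lambda>v. A (B v))) (at (\<phi> x))"
    using has_derivative_compose[OF B, of \<phi> A] A i(2)[OF assms(2)] by simp
  then have "((\<lambda>y. y) has_derivative (\<lambda>v. A (B v))) (at (\<phi> x))"
    by (rule has_derivative_transform_within_open[OF _ U(2) i(1)[OF assms(2)]]) (simp add: i)
  then have "(\<lambda>v. A (B v)) = (\<lambda>v. v)"
    by (rule has_derivative_unique[OF _ has_derivative_ident])
  then show "A (B v) = v" by metis
qed

text \<open>
The difference quotients lie in the subspace, and subspaces of a Euclidean space are closed.
\<close>

lemma has_vector_derivative_in_subspace:
  fixes f :: "real \<Rightarrow> 'a::euclidean_space"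
  assumes "subspace T" "(f has_vector_derivative v) (at t)" "f t \<in> T" "\<forall>\<^sub>F s in at t. f s \<in> T"
  shows "v \<in> T"
proof (rule Lim_in_closed_set)
  show "((\<lambda>s. (1 / (s - t)) *\<^sub>R (f s - f t)) \<longlongrightarrow> v) (at t)"
  proof (subst tendsto_componentwise_iff, rule ballI)
    fix b :: 'a
    have "((\<lambda>s. f s \<bullet> b) has_real_derivative v \<bullet> b) (at t)"
      unfolding has_real_derivative_iff_has_vector_derivative
      by (rule bounded_linear.has_vector_derivative[OF bounded_linear_inner_left assms(2)])
    then show "((\<lambda>s. ((1 / (s - t)) *\<^sub>R (f s - f t)) \<bullet> b) \<longlongrightarrow> v \<bullet> b) (at t)"
      by (simp add: has_field_derivative_iff inner_diff_left)
  qed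
  show "\<forall>\<^sub>F s in at t. (1 / (s - t)) *\<^sub>R (f s - f t) \<in> T"
    using assms(4) by eventually_elim (simp add: assms subspace_diff subspace_scale)
qed (use assms closed_subspace in auto)

lemma chart_image_iff:
  assumes "diffeomorphism U V \<phi>" "\<phi> ` (U \<inter> M) = V \<inter> T" "x \<in> U"
  shows "x \<in> M \<longleftrightarrow> \<phi> x \<in> T"
proof
  assume "\<phi> x \<in> T"
  then have "\<phi> x \<in> \<phi> ` (U \<inter> M)"
    using assms diffeomorphism_inverse(1)[OF assms(1)] by blast
  then show "x \<in> M"
    using assms(3) diffeomorphism_inverse(2)[OF assms(1)] by (metis IntE imageE)
qed (use assms in blast)

text \<open>
Straight segments in the slice \<open>V \<inter> T\<close> of a chart pull back to smooth curves in the submanifold.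
\<close>

lemma chart_derivative_in_tangent_space:
  assumes "diffeomorphism U V \<phi>" "subspace T" "\<phi> ` (U \<inter> M) = V \<inter> T"
    and "y \<in> V" "y \<in> T" "w \<in> T"
  shows "frechet_derivative (inv_into U \<phi>) (at y) w \<in> tangent_space M (inv_into U \<phi> y)"
proof -
  let ?\<psi> = "inv_into U \<phi>"
  have V: "open V" and sm: "smooth_on V ?\<psi>"
    using assms(1) unfolding diffeomorphism_def by auto
  obtain r where r: "r > 0" "ball y r \<subseteq> V"
    using V assms(4) open_contains_ball by blast
  \<comment> \<open>The summand 1 keeps the quotient meaningful when \<open>w = 0\<close>.\<close>
  define \<epsilon> where "\<epsilon> = r / (1 + norm w)"
  have \<epsilon>: "\<epsilon> > 0" using r(1) by (simp add: \<epsilon>_def add_pos_nonneg)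
  have inV: "y + t *\<^sub>R w \<in> V" if "t \<in> {-\<epsilon><..<\<epsilon>}" for t
  proof -
    have "\<bar>t\<bar> * norm w \<le> \<bar>t\<bar> * (1 + norm w)" by (intro mult_left_mono) auto
    also have "\<dots> < r"
      using that by (auto simp: \<epsilon>_def pos_less_divide_eq[symmetric] add_pos_nonneg abs_less_iff)
    finally show ?thesis using r(2) by (auto simp: dist_norm subset_iff)
  qed
  let ?\<gamma> = "\<lambda>t. ?\<psi> (y + t *\<^sub>R w)"
  have "smooth_on {-\<epsilon><..<\<epsilon>} (\<lambda>t. y + t *\<^sub>R w)"
    unfolding smooth_on_def
    by (intro allI Ck_on_add[OF _ Ck_on_const Ck_on_linear[OF _ bounded_linear_scaleR_left Ck_on_id]]
        open_greaterThanLessThan)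
  from smooth_on_compose[OF open_greaterThanLessThan V _ this sm]
  have "smooth_on {-\<epsilon><..<\<epsilon>} ?\<gamma>" using inV by blast
  moreover have "?\<gamma> t \<in> M" if "t \<in> {-\<epsilon><..<\<epsilon>}" for t
    using chart_image_iff[OF assms(1,3)] diffeomorphism_inverse(3,4)[OF assms(1)] inV[OF that] assms
    by (simp add: subspace_add subspace_scale)
  moreover have "(?\<gamma> has_vector_derivative frechet_derivative ?\<psi> (at y) w) (at 0)"
  proof -
    have "((\<lambda>t. y + t *\<^sub>R w) has_vector_derivative w) (at 0)"
      by (auto intro!: derivative_eq_intros simp: has_vector_derivative_def)
    moreover have "(?\<psi> has_derivative frechet_derivative ?\<psi> (at y)) (at (y + 0 *\<^sub>R w))"
      using smooth_on_has_derivative[OF sm assms(4)] by simp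
    ultimately show ?thesis
      using vector_derivative_diff_chain_within[of "\<lambda>t. y + t *\<^sub>R w" w 0 UNIV ?\<psi>]
      by (simp add: o_def has_derivative_at_withinI)
  qed
  ultimately show ?thesis
    unfolding tangent_space_def using \<epsilon> by (auto intro!: exI[of _ ?\<gamma>] exI[of _ \<epsilon>])
qed

text \<open>
Velocities of curves, the way tangent spaces are defined, and the linear space given by a chart are
the same thing: a curve in the submanifold has its image under the chart in \<open>T\<close>, so the velocity of
the image is in \<open>T\<close> as well.
\<close>

lemma tangent_space_chart:
  assumes "diffeomorphism U V \<phi>" "subspace T" "\<phi> ` (U \<inter> M) = V \<inter> T" "q \<in> U" "q \<in> M"
  shows "tangent_space M q = frechet_derivative (inv_into U \<phi>) (at (\<phi> q)) ` T"
proof (intro equalityI subsetI)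
  let ?A = "frechet_derivative \<phi> (at q)" and ?B = "frechet_derivative (inv_into U \<phi>) (at (\<phi> q))"
  fix v assume "v \<in> tangent_space M q"
  then obtain \<gamma> \<epsilon> where \<gamma>: "\<epsilon> > 0" "\<gamma> ` {-\<epsilon><..<\<epsilon>} \<subseteq> M" "\<gamma> 0 = q"
    "(\<gamma> has_vector_derivative v) (at 0)"
    unfolding tangent_space_def by auto
  have U: "open U" "(\<phi> has_derivative ?A) (at q)"
    using assms unfolding diffeomorphism_def by (auto intro: smooth_on_has_derivative)
  have "((\<lambda>t. \<phi> (\<gamma> t)) has_vector_derivative ?A v) (at 0)"
    using vector_derivative_diff_chain_within[OF \<gamma>(4), of \<phi> ?A] U(2) \<gamma>(3)
    by (simp add: o_def has_derivative_at_withinI)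
  moreover have "\<phi> (\<gamma> 0) \<in> T"
    using chart_image_iff[OF assms(1,3,4)] \<gamma>(3) assms(5) by simp
  moreover have "\<forall>\<^sub>F t in at 0. \<phi> (\<gamma> t) \<in> T"
  proof -
    have "(\<gamma> \<longlongrightarrow> q) (at 0)"
      using has_vector_derivative_continuous[OF \<gamma>(4)] \<gamma>(3) by (simp add: continuous_within)
    then have "\<forall>\<^sub>F t in at 0. \<gamma> t \<in> U" using U(1) assms(4) by (rule topological_tendstoD)
    moreover have "\<forall>\<^sub>F t in at 0. t \<in> {-\<epsilon><..<\<epsilon>}"
      using \<gamma>(1) by (intro eventually_at_in_open') auto
    ultimately show ?thesis
      by eventually_elim (use chart_image_iff[OF assms(1,3)] \<gamma>(2) in blast)
  qed
  ultimately have "?A v \<in> T" by (rule has_vector_derivative_in_subspace[OF assms(2)])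
  moreover have "v = ?B (?A v)"
    using diffeomorphism_derivatives_inverse(2)[OF assms(1,4)] by simp
  ultimately show "v \<in> ?B ` T" by blast
next
  fix v assume "v \<in> frechet_derivative (inv_into U \<phi>) (at (\<phi> q)) ` T"
  then show "v \<in> tangent_space M q"
    using chart_derivative_in_tangent_space[OF assms(1-3), of "\<phi> q"] assms(5)
      chart_image_iff[OF assms(1,3,4)] diffeomorphism_inverse[OF assms(1)] assms(4) by auto
qed

text \<open>
In particular the dimension of a submanifold can be read off from its tangent space at any point.
\<close>

lemma tangent_space_submanifold:
  fixes M :: "'a::euclidean_space set"
  assumes "smooth_submanifold d M" "q \<in> M"
  shows "subspace (tangent_space M q)" "dim (tangent_space M q) = d"
proof -
  obtain U V \<phi> T where c: "q \<in> U" "diffeomorphism U V \<phi>" "subspace T" "dim T = d"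
    "\<phi> ` (U \<inter> M) = V \<inter> T"
    using assms unfolding smooth_submanifold_def by metis
  let ?B = "frechet_derivative (inv_into U \<phi>) (at (\<phi> q))"
  have eq: "tangent_space M q = ?B ` T"
    using tangent_space_chart c assms(2) by blast
  have lin: "linear ?B"
    using smooth_on_has_derivative[of V "inv_into U \<phi>" "\<phi> q"] c(1,2) diffeomorphism_inverse(1)[OF c(2)]
    by (auto simp: diffeomorphism_def intro: has_derivative_linear)
  have "inj ?B"
    by (metis diffeomorphism_derivatives_inverse(1)[OF c(2,1)] injI)
  then show "subspace (tangent_space M q)" "dim (tangent_space M q) = d"
    using lin c(3,4) unfolding eq
    by (auto simp: linear_subspace_image dim_image_eq inj_on_subset)
qed

text \<open>
The leaf containing a connected integral manifold is found with this principle, applied to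
quotients of squared radii. In a chart whose image is a ball, nearby points are joined by the
preimage of a segment. Its velocity is tangent to \<open>N\<close>, so \<open>f\<close> is constant along it; hence \<open>f\<close> is
locally constant on \<open>N\<close>.
\<close>

lemma constant_on_connected_submanifold:
  fixes f :: "'a::euclidean_space \<Rightarrow> real"
  assumes "smooth_submanifold d N" "connected N"
    and f: "\<And>x. x \<in> N \<Longrightarrow> (f has_derivative f' x) (at x)"
    and zero: "\<And>x v. x \<in> N \<Longrightarrow> v \<in> tangent_space N x \<Longrightarrow> f' x v = 0"
    and "a \<in> N" "b \<in> N"
  shows "f a = f b"
proof (rule connected_local_const[OF assms(2,5,6)], rule ballI)
  fix q assume "q \<in> N"
  then obtain U V \<phi> T where c: "q \<in> U" "diffeomorphism U V \<phi>" "subspace T" "\<phi> ` (U \<inter> N) = V \<inter> T"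
    using assms(1) unfolding smooth_submanifold_def by metis
  note i = diffeomorphism_inverse[OF c(2)] and mem = chart_image_iff[OF c(2,4)]
  let ?\<psi> = "inv_into U \<phi>"
  have UV: "open U" "open V" "continuous_on U \<phi>" "smooth_on V ?\<psi>"
    using c(2) unfolding diffeomorphism_def by (auto intro: smooth_on_continuous_on)
  obtain r where r: "r > 0" "ball (\<phi> q) r \<subseteq> V"
    using UV(2) i(1)[OF c(1)] open_contains_ball by blast
  define W where "W = U \<inter> \<phi> -` ball (\<phi> q) r"
  have "open W" "q \<in> W"
    unfolding W_def using continuous_open_preimage[OF UV(3,1)] c(1) r(1) by auto
  moreover have "f q = f y" if y: "y \<in> W" "y \<in> N" for y
  proof -
    let ?l = "\<lambda>t. \<phi> q + t *\<^sub>R (\<phi> y - \<phi> q)"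
    have T: "\<phi> q \<in> T" "\<phi> y \<in> T" using mem y \<open>q \<in> N\<close> c(1) by (auto simp: W_def)
    have "((\<lambda>t. f (?\<psi> (?l t))) has_derivative (\<lambda>_. 0)) (at t within {0..1})" if t: "t \<in> {0..1}" for t
    proof -
      have "?l t = (1 - t) *\<^sub>R \<phi> q + t *\<^sub>R \<phi> y" by (simp add: algebra_simps)
      then have "?l t \<in> ball (\<phi> q) r"
        using convex_ball[of "\<phi> q" r] t y r(1) by (auto simp: W_def convex_alt)
      then have lV: "?l t \<in> V" using r(2) by blast
      have lT: "?l t \<in> T" "\<phi> y - \<phi> q \<in> T"
        using T c(3) by (auto simp: subspace_add subspace_scale subspace_diff)
      have N: "?\<psi> (?l t) \<in> N" using mem[OF i(3)[OF lV]] i(4)[OF lV] lT by simp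
      let ?B = "frechet_derivative ?\<psi> (at (?l t))"
      have B: "(?\<psi> has_derivative ?B) (at (?l t))" by (rule smooth_on_has_derivative[OF UV(4) lV])
      have "(?l has_derivative (\<lambda>s. s *\<^sub>R (\<phi> y - \<phi> q))) (at t within {0..1})"
        by (auto intro!: derivative_eq_intros)
      from has_derivative_compose[OF has_derivative_compose[OF this B] f[OF N]]
      have "((\<lambda>t. f (?\<psi> (?l t))) has_derivative
          (\<lambda>s. f' (?\<psi> (?l t)) (?B (s *\<^sub>R (\<phi> y - \<phi> q))))) (at t within {0..1})" .
      moreover have "f' (?\<psi> (?l t)) (?B (s *\<^sub>R (\<phi> y - \<phi> q))) = 0" for s
        using chart_derivative_in_tangent_space[OF c(2,3,4) lV lT(1)] lT(2) c(3) N zero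
        by (simp add: subspace_scale)
      ultimately show ?thesis by simp
    qed
    from has_derivative_zero_unique[OF convex_real_interval(5) this, of 0 1]
    show ?thesis using i(2) c(1) y by (simp add: W_def)
  qed
  ultimately show "\<forall>\<^sub>F y in at q within N. f q = f y"
    unfolding eventually_at_topological by blast
qed

section \<open>A polar chart of the half-plane\<close>

definition rot :: "real \<times> real \<Rightarrow> real \<times> real" where
  "rot z = (- snd z, fst z)"

lemma rot_zero: "rot 0 = 0"
  by (simp add: rot_def zero_prod_def)

text \<open>
Polar coordinates in the half-plane around \<open>q\<close>, in the form that is most convenient for slices: the
logarithm of the squared radius (relative to \<open>q\<close>) turns a scaling of the radius into a translation,
and the tangent of the angle (measured from \<open>q\<close>) is a quotient of two linear functions that takes
all real values. The image is therefore the whole plane, and only \<open>ln\<close>, \<open>exp\<close> and \<open>inverse\<close>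
occur.
\<close>

definition polar_chart :: "real \<times> real \<Rightarrow> real \<times> real \<Rightarrow> real \<times> real" where
  "polar_chart q z = (ln ((z \<bullet> z) / (q \<bullet> q)), (z \<bullet> rot q) / (z \<bullet> q))"

definition polar_chart_inv :: "real \<times> real \<Rightarrow> real \<times> real \<Rightarrow> real \<times> real" where
  "polar_chart_inv q w = exp ((fst w - ln (1 + (snd w)\<^sup>2)) / 2) *\<^sub>R (q + snd w *\<^sub>R rot q)"

text \<open>
The vectors \<open>q\<close> and \<open>rot q\<close> form an orthogonal frame; the coordinates of \<open>z\<close> in it are what
\<open>polar_chart\<close> is made of.
\<close>

lemma rot_frame: "(q \<bullet> q) *\<^sub>R z = (z \<bullet> q) *\<^sub>R q + (z \<bullet> rot q) *\<^sub>R rot q"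
  by (cases q; cases z) (simp add: rot_def algebra_simps)

lemma rot_orthogonal: "rot q \<bullet> rot q = q \<bullet> q" "q \<bullet> rot q = 0" "rot q \<bullet> q = 0"
  by (cases q; simp add: rot_def)+

lemma inner_rot_frame: "(z \<bullet> q)\<^sup>2 + (z \<bullet> rot q)\<^sup>2 = (z \<bullet> z) * (q \<bullet> q)"
  by (cases q; cases z) (simp add: rot_def algebra_simps power2_eq_square)

lemma polar_chart_inv_polar_chart:
  assumes "z \<bullet> q > 0"
  shows "polar_chart_inv q (polar_chart q z) = z"
proof -
  let ?t = "(z \<bullet> rot q) / (z \<bullet> q)" and ?y = "(z \<bullet> q) / (q \<bullet> q)"
  have q: "q \<bullet> q > 0" and z: "z \<bullet> z > 0" using assms by auto
  \<comment> \<open>Pythagoras: with first frame coordinate \<open>y\<close> and slope \<open>t\<close>, the squared relative radius is \<open>y\<^sup>2 + (t y)\<^sup>2\<close>.\<close>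
  have "(z \<bullet> z) / (q \<bullet> q) = ?y\<^sup>2 * (1 + ?t\<^sup>2)"
    using inner_rot_frame[of z q] assms q by (simp add: field_simps power2_eq_square)
  then have "ln ((z \<bullet> z) / (q \<bullet> q)) = ln (?y\<^sup>2) + ln (1 + ?t\<^sup>2)"
    using assms q by (simp only:, subst ln_mult_pos) (auto intro: add_pos_nonneg)
  also have "ln (?y\<^sup>2) = 2 * ln ?y"
    using assms q by (simp add: ln_realpow)
  finally have "exp ((ln ((z \<bullet> z) / (q \<bullet> q)) - ln (1 + ?t\<^sup>2)) / 2) = ?y"
    using assms q by simp
  then have "(q \<bullet> q) *\<^sub>R polar_chart_inv q (polar_chart q z) = (q \<bullet> q) *\<^sub>R z"
    using assms q rot_frame[of q z]
    by (simp add: polar_chart_inv_def polar_chart_def scaleR_add_right)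
  then show ?thesis using q by simp
qed

lemma polar_chart_inv_in_halfplane: "q \<noteq> 0 \<Longrightarrow> polar_chart_inv q w \<bullet> q > 0"
  by (simp add: polar_chart_inv_def inner_add_left rot_orthogonal)

lemma polar_chart_polar_chart_inv:
  assumes "q \<noteq> 0"
  shows "polar_chart q (polar_chart_inv q w) = w"
proof -
  let ?z = "polar_chart_inv q w" and ?l = "ln (1 + (snd w)\<^sup>2)"
  let ?c = "exp ((fst w - ?l) / 2)"
  have p: "1 + (snd w)\<^sup>2 > 0" by (intro add_pos_nonneg) auto
  have c: "?c * ?c = exp (fst w) / (1 + (snd w)\<^sup>2)"
    using p by (simp add: exp_diff flip: exp_add)
  have "?z \<bullet> ?z = (?c * ?c) * ((q \<bullet> q) * (1 + (snd w)\<^sup>2))"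
    by (simp add: polar_chart_inv_def inner_add_left inner_add_right rot_orthogonal power2_eq_square
        algebra_simps)
  then have "(?z \<bullet> ?z) / (q \<bullet> q) = exp (fst w)"
    using assms p unfolding c by simp
  moreover have "(?z \<bullet> rot q) / (?z \<bullet> q) = snd w"
    using assms by (simp add: polar_chart_inv_def inner_add_left rot_orthogonal)
  ultimately show ?thesis by (simp add: polar_chart_def)
qed

lemma open_halfplane: "open {z. z \<bullet> q > (0::real)}"
  by (intro open_Collect_less continuous_intros)

lemma Ck_on_polar_chart:
  assumes "q \<noteq> 0"
  shows "Ck_on m {z. z \<bullet> q > 0} (polar_chart q)"
proof -
  let ?H = "{z. z \<bullet> q > 0}"
  note o = open_halfplane[of q]
  have lin: "Ck_on m ?H (\<lambda>z. z \<bullet> a)" for a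
    by (rule Ck_on_linear[OF o bounded_linear_inner_left Ck_on_id[OF o]])
  have "Ck_on m ?H (\<lambda>z. (z \<bullet> z) * inverse (q \<bullet> q))"
    by (rule Ck_on_bilinear[OF o bounded_bilinear_mult
          Ck_on_bilinear[OF o bounded_bilinear_inner Ck_on_id[OF o] Ck_on_id[OF o]] Ck_on_const[OF o]])
  moreover have "0 < (z \<bullet> z) * inverse (q \<bullet> q)" if "z \<bullet> q > 0" for z
  proof -
    have "z \<noteq> 0" using that by auto
    then show ?thesis using assms by simp
  qed
  then have "(\<lambda>z. (z \<bullet> z) * inverse (q \<bullet> q)) ` ?H \<subseteq> {0<..}"
    by blast
  ultimately have 1: "Ck_on m ?H (\<lambda>z. ln ((z \<bullet> z) * inverse (q \<bullet> q)))"
    by (intro Ck_on_compose[OF o open_greaterThan _ _ Ck_on_ln])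
  have "Ck_on m ?H (\<lambda>z. inverse (z \<bullet> q))"
    by (rule Ck_on_compose[OF o open_greaterThan _ lin Ck_on_inverse]) auto
  with 1 have "Ck_on m ?H (\<lambda>z. (ln ((z \<bullet> z) * inverse (q \<bullet> q)), (z \<bullet> rot q) * inverse (z \<bullet> q)))"
    by (intro Ck_on_Pair[OF o] Ck_on_bilinear[OF o bounded_bilinear_mult lin])
  then show ?thesis
    by (simp add: polar_chart_def[abs_def] divide_inverse)
qed

lemma Ck_on_polar_chart_inv: "Ck_on m UNIV (polar_chart_inv q)"
proof -
  note o = open_UNIV
  have fs: "Ck_on m UNIV (fst :: real \<times> real \<Rightarrow> real)" "Ck_on m UNIV (snd :: real \<times> real \<Rightarrow> real)"
    by (rule Ck_on_linear[OF o bounded_linear_fst Ck_on_id[OF o]]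
        Ck_on_linear[OF o bounded_linear_snd Ck_on_id[OF o]])+
  have "Ck_on m UNIV (\<lambda>w::real \<times> real. 1 + snd w * snd w)"
    by (rule Ck_on_add[OF o Ck_on_const[OF o] Ck_on_bilinear[OF o bounded_bilinear_mult fs(2) fs(2)]])
  moreover have "range (\<lambda>w::real \<times> real. 1 + snd w * snd w) \<subseteq> {0<..}"
    by (auto intro: add_pos_nonneg)
  ultimately have "Ck_on m UNIV (\<lambda>w::real \<times> real. ln (1 + snd w * snd w))"
    by (intro Ck_on_compose[OF o open_greaterThan _ _ Ck_on_ln])
  from Ck_on_linear[OF o bounded_linear_mult_right[of "1/2"]
      Ck_on_add[OF o fs(1) Ck_on_linear[OF o bounded_linear_minus[OF bounded_linear_ident] this]]]
  have "Ck_on m UNIV (\<lambda>w::real \<times> real. (fst w - ln (1 + snd w * snd w)) / 2)"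
    by simp
  from Ck_on_compose[OF o o _ this Ck_on_exp]
  have "Ck_on m UNIV (\<lambda>w::real \<times> real. exp ((fst w - ln (1 + snd w * snd w)) / 2))" by simp
  from Ck_on_bilinear[OF o bounded_bilinear_scaleR this
      Ck_on_add[OF o Ck_on_const[OF o] Ck_on_linear[OF o bounded_linear_scaleR_left fs(2)]]]
  show ?thesis by (simp add: polar_chart_inv_def[abs_def] power2_eq_square)
qed

section \<open>The shape of a vector\<close>

text \<open>
The radii up to a common factor. The leaves turn out to be the fibres of this map.
\<close>

definition shape :: "'a::real_normed_vector ^ 'n::finite \<Rightarrow> real ^ 'n" where
  "shape x = (\<chi> j. norm (x $ j) / norm x)"

lemma norm_vec_scaled:
  assumes "0 \<le> l" "\<And>j. norm (x $ j) = l * norm (y $ j)"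
  shows "norm x = l * norm y"
  using assms by (simp add: norm_vec_def L2_set_right_distrib)

text \<open>
Two vectors \<open>x\<close> and \<open>y \<noteq> 0\<close> have the same shape exactly if one common positive factor relates all
their radii; this is one direction, and the factor for the other is \<open>norm x / norm y\<close>.
\<close>

lemma shape_eqI:
  assumes "0 < l" "\<And>j. norm (x $ j) = l * norm (y $ j)"
  shows "shape x = shape y"
  using norm_vec_scaled[of l x y] assms by (simp add: shape_def vec_eq_iff)

lemma shape_eqD:
  assumes "shape x = shape y" "y \<noteq> 0"
  shows "0 < norm x / norm y" "norm (x $ j) = norm x / norm y * norm (y $ j)" "x \<noteq> 0"
proof -
  have c: "norm (x $ j) / norm x = norm (y $ j) / norm y" for j
    using assms(1) by (auto simp: shape_def vec_eq_iff)
  show "x \<noteq> 0"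
  proof
    assume "x = 0"
    then have "y $ j = 0" for j using c[of j] assms(2) by simp
    then show False using assms(2) by (simp add: vec_eq_iff)
  qed
  with c[of j] assms(2) show "0 < norm x / norm y" "norm (x $ j) = norm x / norm y * norm (y $ j)"
    by (auto simp: field_simps)
qed

lemma norm_shape: "x \<noteq> 0 \<Longrightarrow> norm (shape x) = 1"
  using norm_vec_scaled[of "1 / norm x" "shape x" x] by (simp add: shape_def)

lemma norm_and_shape_eqI:
  assumes "norm C = 1" "0 < l" "\<And>j. norm (x $ j) = l * C $ j"
  shows "norm x = l" "shape x = C"
proof -
  have "norm (x $ j) = l * norm (C $ j)" for j
    using assms(2,3) by (metis abs_mult abs_norm_cancel abs_of_pos real_norm_def)
  then show "norm x = l" using norm_vec_scaled[of l x C] assms(1,2) by simp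
  then show "shape x = C" using assms by (simp add: shape_def vec_eq_iff)
qed

text \<open>
For a unit vector \<open>C\<close> this is the parametric description of the fibre. The case \<open>x = 0\<close> is excluded
automatically, since division by zero gives the zero vector as the shape of \<open>0\<close>.
\<close>

lemma shape_eq_iff:
  assumes "norm C = 1"
  shows "shape x = C \<longleftrightarrow> (\<exists>l>0. \<forall>j. norm (x $ j) = l * C $ j)"
proof
  assume s: "shape x = C"
  then have "x \<noteq> 0" using assms by (auto simp: shape_def zero_vec_def[symmetric])
  then show "\<exists>l>0. \<forall>j. norm (x $ j) = l * C $ j"
    using s by (intro exI[of _ "norm x"]) (auto simp: shape_def)
qed (use assms norm_and_shape_eqI(2) in blast)

definition support_cell :: "'n set \<Rightarrow> ('a::zero ^ 'n::finite) set" where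
  "support_cell J = {x. \<forall>j. x $ j \<noteq> 0 \<longleftrightarrow> j \<in> J}"

lemma shape_eq_support_cell:
  assumes "y \<in> support_cell J" "J \<noteq> {}" "shape x = shape y"
  shows "x \<in> support_cell J"
proof -
  have "y \<noteq> 0" using assms(1,2) by (auto simp: support_cell_def)
  note d = shape_eqD[OF assms(3) this]
  have "x $ j \<noteq> 0 \<longleftrightarrow> y $ j \<noteq> 0" for j
    using d(1) d(2)[of j] by (metis less_irrefl mult_eq_0_iff norm_eq_zero)
  then show ?thesis
    using assms(1) by (simp add: support_cell_def)
qed

section \<open>The foliation of a cell by the fibres of the shape\<close>

text \<open>
The flat chart around \<open>q\<close> applies \<open>polar_chart\<close> to the pairs on which \<open>q\<close> does not vanish and keeps
the other pairs, so that the cell of \<open>q\<close> becomes a linear subspace.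
\<close>

definition flat_dom :: "(real \<times> real) ^ 'n::finite \<Rightarrow> ((real \<times> real) ^ 'n) set" where
  "flat_dom q = {x. \<forall>j. q $ j \<noteq> 0 \<longrightarrow> x $ j \<bullet> q $ j > 0}"

definition flat_chart :: "(real \<times> real) ^ 'n::finite \<Rightarrow> (real \<times> real) ^ 'n \<Rightarrow> (real \<times> real) ^ 'n" where
  "flat_chart q x = (\<chi> j. if q $ j = 0 then x $ j else polar_chart (q $ j) (x $ j))"

definition flat_chart_inv :: "(real \<times> real) ^ 'n::finite \<Rightarrow> (real \<times> real) ^ 'n \<Rightarrow> (real \<times> real) ^ 'n" where
  "flat_chart_inv q v = (\<chi> j. if q $ j = 0 then v $ j else polar_chart_inv (q $ j) (v $ j))"

lemma flat_chart_inverse: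
  shows "x \<in> flat_dom q \<Longrightarrow> flat_chart_inv q (flat_chart q x) = x"
    and "flat_chart q (flat_chart_inv q v) = v" "flat_chart_inv q v \<in> flat_dom q"
  by (auto simp: flat_dom_def flat_chart_def flat_chart_inv_def vec_eq_iff
      polar_chart_inv_polar_chart polar_chart_polar_chart_inv polar_chart_inv_in_halfplane)

lemma open_flat_dom: "open (flat_dom q)"
proof -
  have "flat_dom q = (\<Inter>j\<in>{j. q $ j \<noteq> 0}. {x. x $ j \<bullet> q $ j > 0})"
    by (auto simp: flat_dom_def)
  moreover have "open {x::(real \<times> real) ^ 'a. x $ j \<bullet> q $ j > 0}" for j
    by (intro open_Collect_less continuous_intros)
  ultimately show ?thesis by (simp add: open_INT)
qed

lemma diffeomorphism_flat_chart: "diffeomorphism (flat_dom q) UNIV (flat_chart q)"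
  unfolding diffeomorphism_def
proof (intro conjI)
  note o = open_flat_dom[of q]
  show bij: "bij_betw (flat_chart q) (flat_dom q) UNIV"
    by (rule bij_betw_byWitness[of _ "flat_chart_inv q"]) (auto simp: flat_chart_inverse)
  have nth: "Ck_on m S (\<lambda>x::(real \<times> real) ^ 'a. x $ j)" if "open S" for m S j
    by (rule Ck_on_linear[OF that bounded_linear_vec_nth Ck_on_id[OF that]])
  have "Ck_on m (flat_dom q) (\<lambda>x. flat_chart q x $ j)" for m j
  proof (cases "q $ j = 0")
    case False
    then have "(\<lambda>x. x $ j) ` flat_dom q \<subseteq> {z. z \<bullet> q $ j > 0}" by (auto simp: flat_dom_def)
    from Ck_on_compose[OF o open_halfplane this nth[OF o] Ck_on_polar_chart[OF False]]
    show ?thesis using False by (simp add: flat_chart_def)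
  qed (simp add: flat_chart_def nth[OF o])
  then show "smooth_on (flat_dom q) (flat_chart q)"
    by (simp add: smooth_on_def Ck_on_vec[OF o])
  have "Ck_on m UNIV (\<lambda>v. flat_chart_inv q v $ j)" for m j
    using Ck_on_compose[OF open_UNIV open_UNIV _ nth[OF open_UNIV, of m j] Ck_on_polar_chart_inv[of m "q $ j"]]
    by (cases "q $ j = 0") (simp_all add: flat_chart_inv_def nth)
  then have "Ck_on m UNIV (flat_chart_inv q)" for m
    by (simp add: Ck_on_vec)
  moreover have "inv_into (flat_dom q) (flat_chart q) = flat_chart_inv q"
    using bij by (intro ext inv_into_f_eq) (auto simp: bij_betw_def flat_chart_inverse)
  ultimately show "smooth_on UNIV (inv_into (flat_dom q) (flat_chart q))"
    by (simp add: smooth_on_def)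
qed (simp_all add: open_flat_dom)

text \<open>
The flat chart maps onto the whole space, so images of sets are found by comparing membership
conditions.
\<close>

lemma flat_chart_image:
  assumes "\<And>x. x \<in> flat_dom q \<Longrightarrow> x \<in> M \<longleftrightarrow> flat_chart q x \<in> S"
  shows "flat_chart q ` (flat_dom q \<inter> M) = S"
proof (intro equalityI subsetI)
  fix v assume "v \<in> S"
  then have "flat_chart_inv q v \<in> flat_dom q \<inter> M"
    using assms[of "flat_chart_inv q v"] by (simp add: flat_chart_inverse)
  then show "v \<in> flat_chart q ` (flat_dom q \<inter> M)"
    by (metis flat_chart_inverse(2) imageI)
qed (use assms in auto)

definition supported_on :: "'n set \<Rightarrow> ('a::zero ^ 'n::finite) set" where
  "supported_on J = {v. \<forall>j. j \<notin> J \<longrightarrow> v $ j = 0}"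

text \<open>
The direction of the leaves in a flat chart: scaling all radii by the same factor adds the same
number to all first coordinates, and the angles are free.
\<close>

definition plaque_dir :: "'n set \<Rightarrow> ((real \<times> real) ^ 'n::finite) set" where
  "plaque_dir J = {v \<in> supported_on J. \<exists>c. \<forall>j\<in>J. fst (v $ j) = c}"

lemma subspace_supported_on: "subspace (supported_on J :: ('a::real_vector ^ 'n::finite) set)"
  by (auto simp: subspace_def supported_on_def)

lemma subspace_plaque_dir: "subspace (plaque_dir J)"
proof -
  let ?E = "{v :: (real \<times> real) ^ 'a. \<exists>c. \<forall>j\<in>J. fst (v $ j) = c}"
  have "subspace ?E"
  proof (rule subspaceI)
    fix x y assume "x \<in> ?E" "y \<in> ?E"
    then obtain c d where "\<forall>j\<in>J. fst (x $ j) = c" "\<forall>j\<in>J. fst (y $ j) = d" by blast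
    then have "\<forall>j\<in>J. fst ((x + y) $ j) = c + d" by simp
    then show "x + y \<in> ?E" by blast
  next
    fix r x assume "x \<in> ?E"
    then obtain c where "\<forall>j\<in>J. fst (x $ j) = c" by blast
    then have "\<forall>j\<in>J. fst ((r *\<^sub>R x) $ j) = r * c" by simp
    then show "r *\<^sub>R x \<in> ?E" by blast
  qed auto
  then show ?thesis
    unfolding plaque_dir_def Collect_conj_eq Collect_mem_eq
    by (intro subspace_inter subspace_supported_on)
qed

text \<open>
A basis consists of the common radial direction \<open>r\<close> and one angular direction \<open>a j\<close> for each
\<open>j \<in> J\<close>. These vectors are pairwise orthogonal.
\<close>

lemma dim_plaque_dir:
  assumes "J \<noteq> {}"
  shows "dim (plaque_dir J) = card J + 1"
proof -
  define r :: "(real \<times> real) ^ 'a" where "r = (\<chi> j. if j \<in> J then (1, 0) else 0)"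
  define a :: "'a \<Rightarrow> (real \<times> real) ^ 'a" where "a j = axis j (0, 1)" for j
  have ra: "r \<bullet> a j = 0" "a i \<bullet> a j = (if i = j then 1 else 0)" for i j
    by (auto simp: r_def a_def inner_axis) (simp add: axis_def)
  have r0: "r \<noteq> 0" using assms by (auto simp: r_def vec_eq_iff zero_prod_def)
  have ne: "a j \<noteq> 0" "r \<noteq> a j" for j
    using ra(2)[of j j] ra(1)[of j] by auto
  have inj: "inj_on a J" by (rule inj_onI) (metis ra(2) zero_neq_one)
  let ?B = "insert r (a ` J)"
  have "independent ?B"
    using r0 ne ra by (intro pairwise_orthogonal_independent)
      (auto simp: pairwise_def orthogonal_def inner_commute)
  moreover have "card ?B = card J + 1"
    using ne(2) card_image[OF inj] by (subst card_insert_disjoint) auto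
  moreover have "?B \<subseteq> plaque_dir J"
    by (auto simp: plaque_dir_def supported_on_def r_def a_def axis_def)
  moreover have "plaque_dir J \<subseteq> span ?B"
  proof
    fix v assume v: "v \<in> plaque_dir J"
    obtain i where i: "i \<in> J" using assms by blast
    have "v $ j = (fst (v $ i) *\<^sub>R r + (\<Sum>l\<in>J. snd (v $ l) *\<^sub>R a l)) $ j" for j
    proof -
      have "(\<Sum>l\<in>J. snd (v $ l) *\<^sub>R a l) $ j = (if j \<in> J then (0, snd (v $ j)) else 0)"
        by (simp add: a_def axis_def if_distrib cong: if_cong)
      moreover have "j \<in> J \<Longrightarrow> fst (v $ i) = fst (v $ j)" "j \<notin> J \<Longrightarrow> v $ j = 0"
        using v i by (auto simp: plaque_dir_def supported_on_def)
      ultimately show ?thesis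
        by (simp add: r_def prod_eq_iff)
    qed
    then have "v = fst (v $ i) *\<^sub>R r + (\<Sum>l\<in>J. snd (v $ l) *\<^sub>R a l)" unfolding vec_eq_iff by blast
    also have "\<dots> \<in> span ?B"
      by (intro span_add span_scale span_sum span_base) auto
    finally show "v \<in> span ?B" .
  qed
  ultimately show ?thesis by (metis dim_unique)
qed

lemma flat_chart_support_cell:
  assumes "q \<in> support_cell J" "x \<in> flat_dom q"
  shows "x \<in> support_cell J \<longleftrightarrow> flat_chart q x \<in> supported_on J"
  using assms by (auto simp: support_cell_def flat_dom_def flat_chart_def supported_on_def)

text \<open>
The translation that takes the directions of the plaques to the plaque of the leaf through \<open>y\<close>.
It is the image of \<open>y\<close> under the flat chart with all angles set to zero, which also makes sense for
\<open>y\<close> outside the domain of the chart.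
\<close>

definition leaf_level :: "(real \<times> real) ^ 'n::finite \<Rightarrow> (real \<times> real) ^ 'n \<Rightarrow> (real \<times> real) ^ 'n" where
  "leaf_level q y = (\<chi> j. if q $ j = 0 then 0 else (ln ((y $ j \<bullet> y $ j) / (q $ j \<bullet> q $ j)), 0))"

lemma leaf_level_self: "leaf_level q q = 0"
  by (auto simp: leaf_level_def vec_eq_iff zero_prod_def)

text \<open>
A leaf meets the domain of a flat chart in a single plaque: after subtracting the level of \<open>y\<close>, the
first coordinate at \<open>j \<in> J\<close> is the logarithm of the quotient of the squared radii of \<open>x\<close> and \<open>y\<close>,
and the shapes agree if and only if this quotient is the same for all \<open>j\<close>.
\<close>

lemma flat_chart_leaf:
  assumes q: "q \<in> support_cell J" and y: "y \<in> support_cell J" and J: "J \<noteq> {}" and x: "x \<in> flat_dom q"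
  shows "shape x = shape y \<longleftrightarrow> flat_chart q x - leaf_level q y \<in> plaque_dir J"
proof -
  have qJ: "q $ j = 0 \<longleftrightarrow> j \<notin> J" "y $ j = 0 \<longleftrightarrow> j \<notin> J" for j
    using q y by (auto simp: support_cell_def)
  have pos: "x $ j \<bullet> x $ j > 0" if "j \<in> J" for j
  proof -
    have "x $ j \<bullet> q $ j > 0" using x qJ(1)[of j] that by (simp add: flat_dom_def)
    then have "x $ j \<noteq> 0" by (metis inner_zero_left less_irrefl)
    then show ?thesis by simp
  qed
  have posq: "j \<in> J \<Longrightarrow> q $ j \<bullet> q $ j > 0" "j \<in> J \<Longrightarrow> y $ j \<bullet> y $ j > 0" for j
    using qJ[of j] by auto
  have comp: "fst ((flat_chart q x - leaf_level q y) $ j) = ln ((x $ j \<bullet> x $ j) / (y $ j \<bullet> y $ j))"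
    if "j \<in> J" for j
    using that qJ[of j] pos[OF that] posq[OF that]
    by (simp add: flat_chart_def leaf_level_def polar_chart_def ln_div)
  have out: "(flat_chart q x - leaf_level q y) $ j = x $ j" if "j \<notin> J" for j
    using that qJ[of j] by (simp add: flat_chart_def leaf_level_def)
  have y0: "y \<noteq> 0" using J qJ(2) by (auto simp: vec_eq_iff)
  show ?thesis
  proof
    assume s: "shape x = shape y"
    note d = shape_eqD[OF s y0]
    have "(x $ j \<bullet> x $ j) / (y $ j \<bullet> y $ j) = (norm x / norm y)\<^sup>2" if "j \<in> J" for j
      using posq(2)[OF that] unfolding dot_square_norm d(2)[of j]
      by (simp add: power_mult_distrib power_divide)
    moreover have "x $ j = 0" if "j \<notin> J" for j
      using d(2)[of j] qJ(2)[of j] that by simp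
    ultimately show "flat_chart q x - leaf_level q y \<in> plaque_dir J"
      using comp out by (simp add: plaque_dir_def supported_on_def del: vector_minus_component)
  next
    assume v: "flat_chart q x - leaf_level q y \<in> plaque_dir J"
    then obtain c where c: "\<And>j. j \<in> J \<Longrightarrow> fst ((flat_chart q x - leaf_level q y) $ j) = c"
      unfolding plaque_dir_def by blast
    have "norm (x $ j) = exp (c / 2) * norm (y $ j)" for j
    proof (cases "j \<in> J")
      case True
      then have "ln ((x $ j \<bullet> x $ j) / (y $ j \<bullet> y $ j)) = c"
        using c comp by metis
      then have "(x $ j \<bullet> x $ j) / (y $ j \<bullet> y $ j) = exp c"
        using pos[OF True] posq[OF True] by (metis divide_pos_pos exp_ln)
      then have "x $ j \<bullet> x $ j = exp c * (y $ j \<bullet> y $ j)"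
        using posq(2)[OF True] by (metis less_irrefl nonzero_eq_divide_eq)
      moreover have "(exp (c / 2))\<^sup>2 = exp c" by (simp flip: exp_double)
      ultimately have "(norm (x $ j))\<^sup>2 = (exp (c / 2) * norm (y $ j))\<^sup>2"
        by (simp add: dot_square_norm power_mult_distrib)
      then show ?thesis by (simp add: power2_eq_iff_nonneg)
    next
      case False
      then show ?thesis
        using v out[of j] qJ(2)[of j] by (simp add: plaque_dir_def supported_on_def del: vector_minus_component)
    qed
    then show "shape x = shape y" by (intro shape_eqI[of "exp (c / 2)"]) auto
  qed
qed

lemma flat_dom_self: "q \<in> flat_dom q"
  by (simp add: flat_dom_def)

text \<open>
Around a point \<open>q\<close> of the fibre, the flat chart of \<open>q\<close> itself has level zero, so the plaque is the
linear subspace \<open>plaque_dir J\<close>.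
\<close>

lemma smooth_submanifold_shape_fibre:
  fixes y :: "(real \<times> real) ^ 'n::finite"
  assumes "y \<in> support_cell J" "J \<noteq> {}"
  shows "smooth_submanifold (card J + 1) {x :: (real \<times> real) ^ 'n. shape x = shape y}"
  unfolding smooth_submanifold_def
proof (rule ballI)
  fix q :: "(real \<times> real) ^ 'n" assume "q \<in> {x. shape x = shape y}"
  then have s: "shape q = shape y" by simp
  have q: "q \<in> support_cell J" using shape_eq_support_cell[OF assms s] .
  have "flat_chart q ` (flat_dom q \<inter> {x. shape x = shape y}) = plaque_dir J"
    using flat_chart_leaf[OF q q assms(2)] by (intro flat_chart_image) (simp add: leaf_level_self s)
  then show "\<exists>U V \<phi> T. q \<in> U \<and> diffeomorphism U V \<phi> \<and> subspace T \<and> dim T = card J + 1 \<and>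
      \<phi> ` (U \<inter> {x. shape x = shape y}) = V \<inter> T"
    using flat_dom_self diffeomorphism_flat_chart subspace_plaque_dir dim_plaque_dir[OF assms(2)]
    by (metis Int_UNIV_left)
qed

text \<open>
The fibre is the continuous image of a vector space, with the logarithm of the scaling factor and
the angles as parameters.
\<close>

lemma path_connected_shape_fibre:
  fixes y :: "(real \<times> real) ^ 'n::finite"
  assumes "y \<noteq> 0"
  shows "path_connected {x :: (real \<times> real) ^ 'n. shape x = shape y}"
proof -
  define P :: "real \<times> (real ^ 'n) \<Rightarrow> (real \<times> real) ^ 'n"
    where "P = (\<lambda>(a, \<theta>). \<chi> j. (exp a * norm (y $ j)) *\<^sub>R (cos (\<theta> $ j), sin (\<theta> $ j)))"
  have nP: "norm (P (a, \<theta>) $ j) = exp a * norm (y $ j)" for a \<theta> j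
    by (simp add: P_def norm_Pair del: scaleR_Pair)
  have "P ` UNIV = {x. shape x = shape y}"
  proof (intro equalityI subsetI)
    fix x assume "x \<in> P ` UNIV"
    then show "x \<in> {x. shape x = shape y}"
      using nP by (auto intro!: shape_eqI)
  next
    fix x :: "(real \<times> real) ^ 'n" assume "x \<in> {x. shape x = shape y}"
    then have d: "0 < norm x / norm y" "\<And>j. norm (x $ j) = norm x / norm y * norm (y $ j)"
      using shape_eqD[OF _ assms] by auto
    have "\<exists>t. x $ j = norm (x $ j) *\<^sub>R (cos t, sin t)" for j
    proof (cases "x $ j = 0")
      case False
      then have "(fst (x $ j) / norm (x $ j))\<^sup>2 + (snd (x $ j) / norm (x $ j))\<^sup>2 = 1"
        by (simp add: power_divide norm_prod_def flip: add_divide_distrib)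
          (metis add_nonneg_eq_0_iff prod_eq_iff zero_prod_def fst_zero snd_zero power2_eq_iff zero_le_power2 power_eq_0_iff)
      then obtain t where "fst (x $ j) / norm (x $ j) = cos t" "snd (x $ j) / norm (x $ j) = sin t"
        using sincos_total_2pi by metis
      then show ?thesis using False
        by (intro exI[of _ t] prod_eqI) (auto simp: field_simps)
    qed (simp add: zero_prod_def)
    then obtain \<theta> where \<theta>: "\<And>j. x $ j = norm (x $ j) *\<^sub>R (cos (\<theta> j), sin (\<theta> j))" by metis
    have "x = P (ln (norm x / norm y), \<chi> j. \<theta> j)"
      using \<theta> d by (simp add: P_def vec_eq_iff)
    then show "x \<in> P ` UNIV" by blast
  qed
  moreover have "continuous_on UNIV P"
    unfolding P_def case_prod_beta by (intro continuous_intros)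
  ultimately show ?thesis
    using path_connected_continuous_image[of UNIV P] by (simp add: path_connected_UNIV)
qed

theorem smooth_foliation_shape_fibres:
  assumes "J \<noteq> {}"
  shows "smooth_foliation (card J + 1) (support_cell J :: ((real \<times> real) ^ 'n::finite) set)
     ((\<lambda>C. {x. shape x = C}) ` shape ` (support_cell J :: ((real \<times> real) ^ 'n) set))"
    (is "smooth_foliation _ ?M ?F")
proof -
  have ne: "y \<noteq> 0" if "y \<in> ?M" for y
    using that assms by (auto simp: support_cell_def)
  have "\<Union>?F = {x. \<exists>y\<in>?M. shape x = shape y}"
    by (simp add: set_eq_iff)
  also have "\<dots> = ?M"
    using shape_eq_support_cell[OF _ assms] by (intro equalityI subsetI CollectI) (blast, auto)
  finally have cover: "\<Union>?F = ?M" .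
  have disj: "disjoint ?F"
    by (auto simp: disjoint_def)
  have leaves: "L \<noteq> {} \<and> path_connected L" if "L \<in> ?F" for L
    using that path_connected_shape_fibre ne by auto
  have charts: "\<exists>U V \<phi> T F. q \<in> U \<and> diffeomorphism U V \<phi> \<and> convex V \<and>
        subspace T \<and> dim T = dim (supported_on J :: ((real \<times> real) ^ 'n) set) \<and>
        subspace F \<and> dim F = card J + 1 \<and> F \<subseteq> T \<and>
        \<phi> ` (U \<inter> ?M) = V \<inter> T \<and>
        (\<forall>L\<in>?F. \<exists>A. countable A \<and> \<phi> ` (U \<inter> L) = (\<Union>a\<in>A. {v \<in> V. v - a \<in> F}))"
    if q: "q \<in> ?M" for q
  proof -
    have "\<exists>A. countable A \<and>
        flat_chart q ` (flat_dom q \<inter> L) = (\<Union>a\<in>A. {v \<in> UNIV. v - a \<in> plaque_dir J})"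
      if "L \<in> ?F" for L
    proof -
      from that obtain y where y: "y \<in> ?M" "L = {x. shape x = shape y}" by auto
      have "flat_chart q ` (flat_dom q \<inter> L) = {v. v - leaf_level q y \<in> plaque_dir J}"
        unfolding y(2) using flat_chart_leaf[OF q y(1) assms] by (intro flat_chart_image) simp
      then show ?thesis by (intro exI[of _ "{leaf_level q y}"]) simp
    qed
    moreover have "flat_chart q ` (flat_dom q \<inter> ?M) = UNIV \<inter> supported_on J"
      using flat_chart_support_cell[OF q] by (simp add: flat_chart_image)
    moreover have "plaque_dir J \<subseteq> supported_on J" by (auto simp: plaque_dir_def)
    ultimately show ?thesis
      by (intro exI[of _ "flat_dom q"] exI[of _ UNIV] exI[of _ "flat_chart q"]
          exI[of _ "supported_on J"] exI[of _ "plaque_dir J"])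
        (simp add: flat_dom_self diffeomorphism_flat_chart subspace_supported_on
          subspace_plaque_dir dim_plaque_dir[OF assms])
  qed
  show ?thesis
    unfolding smooth_foliation_def
  proof (intro conjI)
    show "\<forall>L\<in>?F. L \<noteq> {} \<and> path_connected L" using leaves by (rule ballI)
    show "\<exists>d. \<forall>q\<in>?M. \<exists>U V \<phi> T F. q \<in> U \<and> diffeomorphism U V \<phi> \<and> convex V \<and>
        subspace T \<and> dim T = d \<and> subspace F \<and> dim F = card J + 1 \<and> F \<subseteq> T \<and>
        \<phi> ` (U \<inter> ?M) = V \<inter> T \<and>
        (\<forall>L\<in>?F. \<exists>A. countable A \<and> \<phi> ` (U \<inter> L) = (\<Union>a\<in>A. {v \<in> V. v - a \<in> F}))"
      by (rule exI[of _ "dim (supported_on J :: ((real \<times> real) ^ 'n) set)"], rule ballI) (rule charts)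
  qed (fact cover disj)+
qed

section \<open>Eulerian and rotational fields\<close>

lemma E0_eq: "E0 x = x"
  by (simp add: E0_def vec_eq_iff)

lemma Theta0_eq: "Theta0 e i x = axis (e i) (rot (x $ e i))"
  by (simp add: Theta0_def rot_def)

lemma axis_rot_orthogonal: "axis j (rot (x $ j)) $ i \<bullet> x $ i = 0"
  by (simp add: axis_def rot_orthogonal)

text \<open>
Multiplying by a coefficient function does not leave the span of the Euler field and the rotations,
and the constant coefficient \<open>1\<close> on the whole space gives these fields themselves.
\<close>

lemma ER_distribution_span:
  fixes x :: "(real \<times> real) ^ 'n::finite"
  assumes "bij_betw e {1..CARD('n)} UNIV"
  shows "ER_distribution e x = span (insert x (range (\<lambda>j. axis j (rot (x $ j)))))"
    (is "_ = span ?G")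
proof (rule antisym)
  have "x \<in> span ?G" "axis j (rot (x $ j)) \<in> span ?G" for j
    by (auto intro: span_base)
  then show "ER_distribution e x \<subseteq> span ?G"
    unfolding ER_distribution_def
    by (intro span_minimal)
      (auto simp: eulerian_field_def rotational_field_def E0_eq Theta0_eq intro!: span_scale)
  have "x \<in> ER_distribution e x"
    unfolding ER_distribution_def
    by (rule span_base) (auto simp: eulerian_field_def E0_eq smooth_on_const
        intro!: exI[of _ "\<lambda>x. x"] exI[of _ UNIV] exI[of _ "\<lambda>_. 1"])
  moreover have "axis j (rot (x $ j)) \<in> ER_distribution e x" for j
  proof -
    obtain i where i: "i \<in> {1..CARD('n)}" "e i = j"
      using assms by (metis UNIV_I bij_betw_def image_iff)
    then have "rotational_field e UNIV (\<lambda>x. axis j (rot (x $ j)))"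
      unfolding rotational_field_def Theta0_eq
      by (auto intro!: bexI[of _ i] exI[of _ "\<lambda>_. 1"] simp: smooth_on_const)
    then show ?thesis
      unfolding ER_distribution_def by (intro span_base CollectI exI[of _ "\<lambda>x. axis j (rot (x $ j))"] exI[of _ UNIV]) simp
  qed
  ultimately show "span ?G \<subseteq> ER_distribution e x"
    by (intro span_minimal) (auto simp: ER_distribution_def)
qed

text \<open>
The distribution in terms of equations: tangent vectors are those for which the relative
change of the radius is the same in all pairs, and which do not move the pairs that vanish. The
component of \<open>v\<close> orthogonal to the radial direction is accounted for by the rotations.
\<close>

lemma ER_distribution_eq:
  fixes x :: "(real \<times> real) ^ 'n::finite"
  assumes "bij_betw e {1..CARD('n)} UNIV"
  shows "ER_distribution e x =
    {v. (\<exists>a. \<forall>j. v $ j \<bullet> x $ j = a * (x $ j \<bullet> x $ j)) \<and> (\<forall>j. x $ j = 0 \<longrightarrow> v $ j = 0)}"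
    (is "_ = ?R")
proof -
  let ?G = "insert x (range (\<lambda>j. axis j (rot (x $ j))))"
  have "span ?G \<subseteq> ?R"
  proof (rule span_minimal)
    have "\<exists>a. \<forall>i. axis j (rot (x $ j)) $ i \<bullet> x $ i = a * (x $ i \<bullet> x $ i)" for j
      by (rule exI[of _ 0]) (simp add: axis_rot_orthogonal)
    moreover have "axis j (rot (x $ j)) $ i = 0" if "x $ i = 0" for i j
      using that by (auto simp: axis_def rot_zero)
    ultimately show "?G \<subseteq> ?R" by (auto intro: exI[of _ 1])
    show "subspace ?R"
    proof (rule subspaceI)
      show "0 \<in> ?R" by (auto intro: exI[of _ 0])
    next
      fix v w assume v: "v \<in> ?R" and w: "w \<in> ?R"
      from v w obtain a b where "\<forall>j. v $ j \<bullet> x $ j = a * (x $ j \<bullet> x $ j)"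
        "\<forall>j. w $ j \<bullet> x $ j = b * (x $ j \<bullet> x $ j)" by blast
      then have "\<forall>j. (v + w) $ j \<bullet> x $ j = (a + b) * (x $ j \<bullet> x $ j)"
        by (simp add: inner_add_left distrib_right)
      then show "v + w \<in> ?R" using v w by auto
    next
      fix c v assume v: "v \<in> ?R"
      then obtain a where "\<forall>j. v $ j \<bullet> x $ j = a * (x $ j \<bullet> x $ j)" by blast
      then have "\<forall>j. (c *\<^sub>R v) $ j \<bullet> x $ j = (c * a) * (x $ j \<bullet> x $ j)" by simp
      then show "c *\<^sub>R v \<in> ?R" using v by auto
    qed
  qed
  moreover have "v \<in> span ?G" if v: "v \<in> ?R" for v
  proof -
    obtain a where a: "\<And>j. v $ j \<bullet> x $ j = a * (x $ j \<bullet> x $ j)" and z: "\<And>j. x $ j = 0 \<Longrightarrow> v $ j = 0"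
      using v by blast
    define b where "b j = (v $ j \<bullet> rot (x $ j)) / (x $ j \<bullet> x $ j)" for j
    have "v $ j = (a *\<^sub>R x + (\<Sum>i\<in>UNIV. b i *\<^sub>R axis i (rot (x $ i)))) $ j" for j
    proof (cases "x $ j = 0")
      case True
      then show ?thesis using z by (simp add: axis_def if_distrib rot_zero cong: if_cong)
    next
      case False
      then have p: "x $ j \<bullet> x $ j \<noteq> 0" by simp
      have "(x $ j \<bullet> x $ j) *\<^sub>R v $ j = (x $ j \<bullet> x $ j) *\<^sub>R (a *\<^sub>R x $ j + b j *\<^sub>R rot (x $ j))"
        unfolding rot_frame[of "x $ j" "v $ j"] a using p by (simp add: b_def scaleR_add_right mult.commute)
      then have "v $ j = a *\<^sub>R x $ j + b j *\<^sub>R rot (x $ j)" using p by (metis scaleR_left_imp_eq)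
      then show ?thesis by (simp add: axis_def if_distrib cong: if_cong)
    qed
    then have "v = a *\<^sub>R x + (\<Sum>i\<in>UNIV. b i *\<^sub>R axis i (rot (x $ i)))"
      unfolding vec_eq_iff by blast
    also have "\<dots> \<in> span ?G"
      by (intro span_add span_scale span_sum span_base) auto
    finally show ?thesis .
  qed
  ultimately show ?thesis
    unfolding ER_distribution_span[OF assms] by blast
qed

lemma dim_ER_distribution_le:
  fixes x :: "(real \<times> real) ^ 'n::finite"
  assumes "bij_betw e {1..CARD('n)} UNIV" "x \<in> support_cell J"
  shows "dim (ER_distribution e x) \<le> card J + 1"
proof -
  let ?B = "insert x ((\<lambda>j. axis j (rot (x $ j))) ` J)"
  have zero: "axis j (rot (x $ j)) = 0" if "j \<notin> J" for j
  proof -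
    have "x $ j = 0" using that assms(2) by (auto simp: support_cell_def)
    then show ?thesis by (simp add: rot_zero)
  qed
  have "axis j (rot (x $ j)) \<in> span ?B" for j
    by (cases "j \<in> J") (simp_all add: zero span_zero span_base)
  moreover have "x \<in> span ?B" by (simp add: span_base)
  ultimately have "insert x (range (\<lambda>j. axis j (rot (x $ j)))) \<subseteq> span ?B"
    by blast
  then have "ER_distribution e x \<subseteq> span ?B"
    unfolding ER_distribution_span[OF assms(1)] by (intro span_minimal) auto
  then have "dim (ER_distribution e x) \<le> card ?B"
    by (intro dim_le_card) auto
  also have "\<dots> \<le> card J + 1"
    using card_image_le[of J "\<lambda>j. axis j (rot (x $ j))"] by (simp add: card_insert_if)
  finally show ?thesis .
qed

text \<open>
Along a curve in the fibre, each squared radius is a constant multiple of the squared norm.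
Differentiating this identity yields the equations of the distribution, hence one inclusion. The
other follows by comparing dimensions: at most \<open>card J + 1\<close> of the generators of the distribution
are different from zero.
\<close>

lemma tangent_space_shape_fibre:
  fixes x y :: "(real \<times> real) ^ 'n::finite"
  assumes e: "bij_betw e {1..CARD('n)} UNIV" and y: "y \<in> support_cell J" "J \<noteq> {}"
    and x: "shape x = shape y"
  shows "tangent_space {x. shape x = shape y} x = ER_distribution e x"
proof (rule subspace_dim_equal)
  have xJ: "x \<in> support_cell J" by (rule shape_eq_support_cell[OF y x])
  have x0: "x \<noteq> 0" using xJ y(2) by (auto simp: support_cell_def)
  note sm = smooth_submanifold_shape_fibre[OF y]
  show "subspace (tangent_space {x. shape x = shape y} x)"
    using tangent_space_submanifold(1)[OF sm] x by simp
  show "dim (tangent_space {x. shape x = shape y} x) \<ge> dim (ER_distribution e x)"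
    using tangent_space_submanifold(2)[OF sm, of x] x dim_ER_distribution_le[OF e xJ] by simp
  show "subspace (ER_distribution e x)" by (simp add: ER_distribution_def)
  show "tangent_space {x. shape x = shape y} x \<subseteq> ER_distribution e x"
  proof
    fix v assume "v \<in> tangent_space {x. shape x = shape y} x"
    then obtain \<gamma> \<epsilon> where \<gamma>: "\<epsilon> > 0" "\<And>t. t \<in> {-\<epsilon><..<\<epsilon>} \<Longrightarrow> shape (\<gamma> t) = shape y" "\<gamma> 0 = x"
      "(\<gamma> has_vector_derivative v) (at 0)"
      unfolding tangent_space_def image_subset_iff by blast
    have nth: "((\<lambda>t. \<gamma> t $ j) has_vector_derivative v $ j) (at 0)" for j
      by (rule bounded_linear.has_vector_derivative[OF bounded_linear_vec_nth \<gamma>(4)])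
    define c where "c j = (shape y $ j)\<^sup>2" for j
    have inn: "\<gamma> t $ j \<bullet> \<gamma> t $ j = c j * (\<gamma> t \<bullet> \<gamma> t)" if "t \<in> {-\<epsilon><..<\<epsilon>}" for t j
    proof -
      have "\<gamma> t \<noteq> 0"
        using shape_eq_support_cell[OF y \<gamma>(2)[OF that]] y(2) by (auto simp: support_cell_def)
      moreover have "c j = (norm (\<gamma> t $ j) / norm (\<gamma> t))\<^sup>2"
        unfolding c_def \<gamma>(2)[OF that, symmetric] by (simp add: shape_def)
      ultimately show ?thesis by (simp add: power_divide dot_square_norm)
    qed
    have "v $ j \<bullet> x $ j = (x \<bullet> v) / (x \<bullet> x) * (x $ j \<bullet> x $ j)" for j
    proof -
      have 1: "((\<lambda>t. \<gamma> t $ j \<bullet> \<gamma> t $ j) has_vector_derivative 2 * (v $ j \<bullet> x $ j)) (at 0)"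
        using bounded_bilinear.has_vector_derivative[OF bounded_bilinear_inner nth nth, of j j] \<gamma>(3)
        by (simp add: inner_commute)
      have "((\<lambda>t. \<gamma> t \<bullet> \<gamma> t) has_vector_derivative 2 * (x \<bullet> v)) (at 0)"
        using bounded_bilinear.has_vector_derivative[OF bounded_bilinear_inner \<gamma>(4) \<gamma>(4)] \<gamma>(3)
        by (simp add: inner_commute)
      then have "((\<lambda>t. c j * (\<gamma> t \<bullet> \<gamma> t)) has_vector_derivative c j * (2 * (x \<bullet> v))) (at 0)"
        by (rule bounded_linear.has_vector_derivative[OF bounded_linear_mult_right])
      then have "((\<lambda>t. \<gamma> t $ j \<bullet> \<gamma> t $ j) has_vector_derivative c j * (2 * (x \<bullet> v))) (at 0)"
        by (rule has_vector_derivative_transform_within_open[of _ _ _ "{-\<epsilon><..<\<epsilon>}"])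
          (use inn \<gamma>(1) in auto)
      from vector_derivative_unique_at[OF 1 this]
      have "v $ j \<bullet> x $ j = c j * (x \<bullet> v)" by simp
      moreover have "x $ j \<bullet> x $ j = c j * (x \<bullet> x)"
        using inn[of 0 j] \<gamma>(1,3) by simp
      ultimately show ?thesis using x0 by simp
    qed
    moreover have "v $ j = 0" if "x $ j = 0" for j
    proof -
      have "((\<lambda>t. \<gamma> t $ j) has_vector_derivative 0) (at 0)"
      proof (rule has_vector_derivative_transform_within_open[of "\<lambda>_. 0" _ _ "{-\<epsilon><..<\<epsilon>}"])
        fix t assume "t \<in> {-\<epsilon><..<\<epsilon>}"
        then show "0 = \<gamma> t $ j"
          using shape_eq_support_cell[OF y \<gamma>(2)] xJ that by (auto simp: support_cell_def)
      qed (use \<gamma>(1) in auto)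
      then show ?thesis using vector_derivative_unique_at[OF nth] by blast
    qed
    ultimately show "v \<in> ER_distribution e x"
      unfolding ER_distribution_eq[OF e] by blast
  qed
qed

lemma integral_manifold_shape_fibre:
  fixes y :: "(real \<times> real) ^ 'n::finite"
  assumes e: "bij_betw e {1..CARD('n)} UNIV" and y: "y \<in> support_cell J" "J \<noteq> {}"
  shows "integral_manifold e {x. shape x = shape y}"
proof -
  have "y \<noteq> 0" using y by (auto simp: support_cell_def)
  then show ?thesis
    unfolding integral_manifold_def
    using smooth_submanifold_shape_fibre[OF y] tangent_space_shape_fibre[OF e y]
      path_connected_imp_connected[OF path_connected_shape_fibre] by blast
qed

text \<open>
This is the maximality of the leaves. On the distribution the derivative of \<open>norm (x $ j)\<close> squared
over \<open>norm x\<close> squared vanishes, so this quotient is constant on the connected manifold \<open>N\<close>,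
provided that it does not contain the origin. At the origin the distribution is zero, whereas it is
nonzero at \<open>y\<close>; as the dimension of the tangent spaces of \<open>N\<close> does not vary, the origin
is not in \<open>N\<close>.
\<close>

lemma integral_manifold_shape_constant:
  fixes N :: "((real \<times> real) ^ 'n::finite) set"
  assumes e: "bij_betw e {1..CARD('n)} UNIV" and N: "integral_manifold e N"
    and x: "x \<in> N" and y: "y \<in> N" "y \<noteq> 0"
  shows "shape x = shape y"
proof -
  obtain d where sm: "smooth_submanifold d N" and con: "connected N"
    and tan: "\<And>z. z \<in> N \<Longrightarrow> tangent_space N z = ER_distribution e z"
    using N unfolding integral_manifold_def by blast
  have "y \<in> ER_distribution e y"
    unfolding ER_distribution_span[OF e] by (simp add: span_base)
  then have "d \<noteq> 0"
    using tangent_space_submanifold(2)[OF sm y(1)] tan[OF y(1)] y(2) by (metis dim_eq_0 singletonD subsetD)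
  have n0: "z \<noteq> 0" if "z \<in> N" for z
  proof
    assume "z = 0"
    then have "ER_distribution e z = {0}"
      unfolding ER_distribution_eq[OF e] by (auto simp: vec_eq_iff)
    then show False
      using tangent_space_submanifold(2)[OF sm that] tan[OF that] \<open>d \<noteq> 0\<close> by simp
  qed
  have const: "(x $ j \<bullet> x $ j) / (x \<bullet> x) = (y $ j \<bullet> y $ j) / (y \<bullet> y)" for j
  proof (rule constant_on_connected_submanifold[OF sm con _ _ x y(1), of "\<lambda>z. (z $ j \<bullet> z $ j) / (z \<bullet> z)"])
    fix z assume z: "z \<in> N"
    let ?f' = "\<lambda>z v. (2 * (v $ j \<bullet> z $ j) * (z \<bullet> z) - (z $ j \<bullet> z $ j) * (2 * (v \<bullet> z))) / ((z \<bullet> z) * (z \<bullet> z))"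
    have "((\<lambda>z. z $ j \<bullet> z $ j) has_derivative (\<lambda>v. 2 * (v $ j \<bullet> z $ j))) (at z)"
      by (rule has_derivative_eq_rhs[OF has_derivative_inner[OF bounded_linear_imp_has_derivative[OF bounded_linear_vec_nth] bounded_linear_imp_has_derivative[OF bounded_linear_vec_nth]]])
        (simp add: fun_eq_iff inner_commute)
    moreover have "((\<lambda>z. z \<bullet> z) has_derivative (\<lambda>v. 2 * (v \<bullet> z))) (at z)"
      by (rule has_derivative_eq_rhs[OF has_derivative_inner[OF has_derivative_ident has_derivative_ident]])
        (simp add: fun_eq_iff inner_commute)
    ultimately show "((\<lambda>z. (z $ j \<bullet> z $ j) / (z \<bullet> z)) has_derivative ?f' z) (at z)"
      using n0[OF z] by (intro has_derivative_divide') auto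
    fix v assume "v \<in> tangent_space N z"
    then obtain a where a: "\<And>i. v $ i \<bullet> z $ i = a * (z $ i \<bullet> z $ i)"
      unfolding tan[OF z] ER_distribution_eq[OF e] by blast
    then have "v \<bullet> z = a * (z \<bullet> z)"
      by (simp add: inner_vec_def sum_distrib_left)
    then show "?f' z v = 0" using a by simp
  qed
  have "norm (x $ j) / norm x = norm (y $ j) / norm y" for j
  proof -
    have "(norm (x $ j) / norm x)\<^sup>2 = (norm (y $ j) / norm y)\<^sup>2"
      using const[of j] by (simp add: power_divide dot_square_norm)
    then show ?thesis by (simp add: power2_eq_iff_nonneg)
  qed
  then show ?thesis by (simp add: shape_def)
qed

text \<open>
The hypothesis on \<open>X\<close> says that all squared radii \<open>s\<close> satisfy the same linear equation
\<open>s' = 2 g s\<close> along an integral curve. With an antiderivative \<open>H\<close> of \<open>g\<close> along the curve, each product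
\<open>exp (- 2 H) s\<close> is constant. Hence all radii are multiplied by the same positive factor and the shape
is preserved.
\<close>

lemma invariant_under_shape_fibre:
  fixes X :: "(real \<times> real) ^ 'n::finite \<Rightarrow> (real \<times> real) ^ 'n"
  assumes g: "continuous_on \<Omega> g"
    and X: "\<And>x j. x \<in> \<Omega> \<Longrightarrow> X x $ j \<bullet> x $ j = g x * (x $ j \<bullet> x $ j)"
  shows "invariant_under X \<Omega> {x. shape x = C}"
  unfolding invariant_under_def
proof (intro allI impI subsetI)
  fix I \<gamma> t0 z
  assume a: "integral_curve X \<Omega> I \<gamma> \<and> t0 \<in> I \<and> \<gamma> t0 \<in> {x. shape x = C}" and "z \<in> \<gamma> ` I"
  then obtain t where t: "t \<in> I" "z = \<gamma> t" by blast
  have t0: "t0 \<in> I" and I: "is_interval I"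
    and \<gamma>: "\<And>u. u \<in> I \<Longrightarrow> \<gamma> u \<in> \<Omega>" "\<And>u. u \<in> I \<Longrightarrow> (\<gamma> has_vector_derivative X (\<gamma> u)) (at u within I)"
    using a unfolding integral_curve_def by auto
  \<comment> \<open>The interval of the curve need not be compact, so the antiderivative is taken between the two times only.\<close>
  let ?K = "{min t0 t..max t0 t}"
  have KI: "?K \<subseteq> I"
  proof
    fix u assume "u \<in> ?K"
    moreover have "min t0 t \<in> I" "max t0 t \<in> I" using t(1) t0 by (simp_all add: min_def max_def)
    ultimately show "u \<in> I" using mem_is_interval_1_I[OF I] by (meson atLeastAtMost_iff)
  qed
  have "continuous_on I \<gamma>"
    using \<gamma>(2) by (auto simp: continuous_on_eq_continuous_within intro: has_vector_derivative_continuous)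
  then have "continuous_on ?K (\<lambda>u. g (\<gamma> u))"
    using KI \<gamma>(1) by (intro continuous_on_compose2[OF g]) (auto intro: continuous_on_subset)
  then obtain H where H: "\<And>u. u \<in> ?K \<Longrightarrow> (H has_vector_derivative g (\<gamma> u)) (at u within ?K)"
    using antiderivative_continuous by blast
  have zero: "((\<lambda>u. exp (- 2 * H u) * (\<gamma> u $ j \<bullet> \<gamma> u $ j)) has_derivative (\<lambda>_. 0)) (at u within ?K)"
    if u: "u \<in> ?K" for u j
  proof -
    have uI: "u \<in> I" using u KI by blast
    have "((\<lambda>u. \<gamma> u $ j) has_vector_derivative X (\<gamma> u) $ j) (at u within ?K)"
      by (rule bounded_linear.has_vector_derivative[OF bounded_linear_vec_nth
            has_vector_derivative_within_subset[OF \<gamma>(2)[OF uI] KI]])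
    from bounded_bilinear.has_vector_derivative[OF bounded_bilinear_inner this this]
    have "((\<lambda>u. \<gamma> u $ j \<bullet> \<gamma> u $ j) has_real_derivative 2 * (g (\<gamma> u) * (\<gamma> u $ j \<bullet> \<gamma> u $ j))) (at u within ?K)"
      using X[OF \<gamma>(1)[OF uI], of j]
      by (simp add: inner_commute has_real_derivative_iff_has_vector_derivative)
    moreover have "(H has_real_derivative g (\<gamma> u)) (at u within ?K)"
      using H[OF u] by (simp add: has_real_derivative_iff_has_vector_derivative)
    ultimately have "((\<lambda>u. exp (- 2 * H u) * (\<gamma> u $ j \<bullet> \<gamma> u $ j)) has_real_derivative 0) (at u within ?K)"
      by (auto intro!: derivative_eq_intros)
    then show ?thesis
      by (simp add: has_field_derivative_def lambda_zero)
  qed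
  have const: "exp (- 2 * H t) * (\<gamma> t $ j \<bullet> \<gamma> t $ j) = exp (- 2 * H t0) * (\<gamma> t0 $ j \<bullet> \<gamma> t0 $ j)" for j
    using has_derivative_zero_unique[OF convex_real_interval(5) zero[of _ j], of t t0] by simp
  have "norm (\<gamma> t $ j) = exp (H t - H t0) * norm (\<gamma> t0 $ j)" for j
  proof -
    have "\<gamma> t $ j \<bullet> \<gamma> t $ j = exp (2 * H t) * (exp (- 2 * H t) * (\<gamma> t $ j \<bullet> \<gamma> t $ j))"
      by (simp flip: exp_add mult.assoc)
    also have "\<dots> = (exp (H t - H t0))\<^sup>2 * (\<gamma> t0 $ j \<bullet> \<gamma> t0 $ j)"
      by (subst const) (simp_all flip: exp_add exp_double mult.assoc)
    finally have "(norm (\<gamma> t $ j))\<^sup>2 = (exp (H t - H t0) * norm (\<gamma> t0 $ j))\<^sup>2"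
      by (simp add: dot_square_norm power_mult_distrib)
    then show ?thesis by (simp add: power2_eq_iff_nonneg)
  qed
  then have "shape (\<gamma> t) = shape (\<gamma> t0)"
    by (intro shape_eqI[of "exp (H t - H t0)"]) auto
  then show "z \<in> {x. shape x = C}" using a t(2) by simp
qed

lemma flow_invariant_shape_fibre: "flow_invariant e {x. shape x = C}"
  unfolding flow_invariant_def
proof (intro allI impI)
  fix \<Omega> :: "((real \<times> real) ^ 'a) set" and \<omega> :: "nat \<Rightarrow> real" and f :: "nat \<Rightarrow> _ \<Rightarrow> real" and g :: "_ \<Rightarrow> real"
  assume a: "open \<Omega> \<and> 0 \<in> \<Omega> \<and> (\<forall>i\<in>{1..CARD('a)}. smooth_on \<Omega> (f i) \<and> f i 0 = 0) \<and>
    smooth_on \<Omega> g \<and> g 0 = 0 \<and> (\<Prod>i = 1..CARD('a). \<omega> i) \<noteq> 0 \<and>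
    (\<forall>i j. 1 \<le> i \<and> i < j \<and> j \<le> CARD('a) \<longrightarrow> \<omega> i / \<omega> j \<notin> \<rat>)"
  show "invariant_under (\<lambda>x. (\<Sum>i = 1..CARD('a). \<omega> i *\<^sub>R Theta0 e i x) +
      (\<Sum>i = 1..CARD('a). f i x *\<^sub>R Theta0 e i x) + g x *\<^sub>R E0 x) \<Omega> {x. shape x = C}"
    using a by (intro invariant_under_shape_fibre[of _ g])
      (auto simp: smooth_on_continuous_on Theta0_eq E0_eq inner_add_left inner_sum_left axis_rot_orthogonal)
qed

lemma minimal_invariant_manifold_shape_fibre:
  fixes y :: "(real \<times> real) ^ 'n::finite"
  assumes e: "bij_betw e {1..CARD('n)} UNIV" and y: "y \<in> support_cell J" "J \<noteq> {}"
  shows "minimal_invariant_manifold e {x. shape x = shape y}"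
  unfolding minimal_invariant_manifold_def
proof (intro conjI allI impI)
  show "integral_manifold e {x. shape x = shape y}"
    by (rule integral_manifold_shape_fibre[OF e y])
next
  fix N assume N: "integral_manifold e N \<and> {x. shape x = shape y} \<subseteq> N"
  moreover have "y \<noteq> 0" using y by (auto simp: support_cell_def)
  ultimately show "N = {x. shape x = shape y}"
    using integral_manifold_shape_constant[OF e, of N _ y] by blast
next
  fix \<Omega> X assume "eulerian_field \<Omega> X \<or> rotational_field e \<Omega> X"
  then show "invariant_under X \<Omega> {x. shape x = shape y}"
  proof
    assume "eulerian_field \<Omega> X"
    then obtain g where "smooth_on \<Omega> g" "X = (\<lambda>x. g x *\<^sub>R x)"
      by (auto simp: eulerian_field_def E0_eq)
    then show ?thesis
      by (intro invariant_under_shape_fibre[of _ g]) (auto simp: smooth_on_continuous_on)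
  next
    assume "rotational_field e \<Omega> X"
    then obtain i f where "X = (\<lambda>x. f x *\<^sub>R axis (e i) (rot (x $ e i)))"
      by (auto simp: rotational_field_def Theta0_eq)
    then show ?thesis
      by (intro invariant_under_shape_fibre[of _ "\<lambda>_. 0"]) (auto simp: axis_rot_orthogonal)
  qed
qed

section \<open>Coordinates of cells and leaves\<close>

lemma continuous_map_scaleR:
  fixes f :: "'a \<Rightarrow> real" and g :: "'a \<Rightarrow> 'b::real_normed_vector"
  shows "continuous_map X euclidean f \<Longrightarrow> continuous_map X euclidean g \<Longrightarrow>
    continuous_map X euclidean (\<lambda>x. f x *\<^sub>R g x)"
  by (simp add: continuous_map_atin tendsto_scaleR)

lemma continuous_map_vec_lambda:
  fixes f :: "'n::finite \<Rightarrow> 'a \<Rightarrow> 'b::topological_space"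
  shows "(\<And>j. continuous_map X euclidean (f j)) \<Longrightarrow> continuous_map X euclidean (\<lambda>x. \<chi> j. f j x)"
  by (simp add: continuous_map_atin tendsto_vec_lambda)

lemma power2_norm_vec:
  fixes C :: "real ^ 'n::finite"
  assumes "bij_betw s {1..k} J" "\<And>j. j \<notin> J \<Longrightarrow> C $ j = 0"
  shows "(norm C)\<^sup>2 = (\<Sum>i=1..k. (C $ s i)\<^sup>2)"
proof -
  have "(norm C)\<^sup>2 = (\<Sum>j\<in>UNIV. (C $ j)\<^sup>2)"
    unfolding power2_norm_eq_inner inner_vec_def by (simp add: power2_eq_square)
  also have "\<dots> = (\<Sum>j\<in>J. (C $ j)\<^sup>2)"
    using assms(2) by (intro sum.mono_neutral_right) auto
  also have "\<dots> = (\<Sum>i=1..k. (C $ s i)\<^sup>2)"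
    by (rule sum.reindex_bij_betw[OF assms(1), symmetric])
  finally show ?thesis .
qed

text \<open>
Polar decomposition of a point of the cell into its directions, its norm and its shape. Families
indexed by \<open>{1..k}\<close> are extensional functions, and \<open>s\<close> translates their indices to coordinate pairs.
\<close>

definition cell_coords :: "nat \<Rightarrow> (nat \<Rightarrow> 'n) \<Rightarrow> (real \<times> real) ^ 'n::finite \<Rightarrow>
    (nat \<Rightarrow> real \<times> real) \<times> real \<times> (nat \<Rightarrow> real)" where
  "cell_coords k s x = ((\<lambda>i\<in>{1..k}. sgn (x $ s i)), norm x, (\<lambda>i\<in>{1..k}. shape x $ s i))"

definition cell_point :: "nat \<Rightarrow> (nat \<Rightarrow> 'n) \<Rightarrow>
    (nat \<Rightarrow> real \<times> real) \<times> real \<times> (nat \<Rightarrow> real) \<Rightarrow> (real \<times> real) ^ 'n::finite" where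
  "cell_point k s = (\<lambda>(u, r, c). \<chi> j. if j \<in> s ` {1..k}
     then (r * c (inv_into {1..k} s j)) *\<^sub>R u (inv_into {1..k} s j) else 0)"

lemma topspace_torus: "topspace (torus k) = {1..k} \<rightarrow>\<^sub>E sphere (0, 0) 1"
  by (simp add: torus_def)

lemma topspace_positive_sphere:
  "topspace (positive_sphere k) =
    {c \<in> extensional {1..k}. (\<Sum>i=1..k. (c i)\<^sup>2) = 1 \<and> (\<forall>i\<in>{1..k}. c i > 0)}"
  by (auto simp: positive_sphere_def PiE_def)

lemma cell_point_coords:
  fixes s :: "nat \<Rightarrow> 'n::finite"
  assumes "inj_on s {1..k}" "1 \<le> k" "u \<in> topspace (torus k)" "r > 0" "c \<in> topspace (positive_sphere k)"
  shows "cell_point k s (u, r, c) \<in> support_cell (s ` {1..k})" (is ?A)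
    and "cell_coords k s (cell_point k s (u, r, c)) = (u, r, c)" (is ?B)
proof -
  let ?p = "inv_into {1..k} s"
  define C :: "real ^ 'n" where "C = (\<chi> j. if j \<in> s ` {1..k} then c (?p j) else 0)"
  define x where "x = cell_point k s (u, r, c)"
  have c: "c \<in> extensional {1..k}" "(\<Sum>i=1..k. (c i)\<^sup>2) = 1" "\<And>i. i \<in> {1..k} \<Longrightarrow> c i > 0"
    using assms(5) by (auto simp: topspace_positive_sphere)
  have u: "u \<in> extensional {1..k}" "\<And>i. i \<in> {1..k} \<Longrightarrow> norm (u i) = 1"
    using assms(3) by (auto simp: topspace_torus PiE_def dist_norm norm_minus_commute zero_prod_def[symmetric])
  have xs: "x $ s i = (r * c i) *\<^sub>R u i" and Cs: "C $ s i = c i" if "i \<in> {1..k}" for i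
    using that assms(1) by (simp_all add: x_def cell_point_def C_def)
  have out: "x $ j = 0" "C $ j = 0" if "j \<notin> s ` {1..k}" for j
    using that by (simp_all add: x_def cell_point_def C_def)
  have "(norm C)\<^sup>2 = 1"
    using power2_norm_vec[of s k "s ` {1..k}" C] assms(1) c(2) out Cs by (simp add: bij_betw_def)
  then have C1: "norm C = 1" by (simp add: power2_eq_1_iff) (metis norm_ge_zero not_one_le_zero neg_0_le_iff_le)
  have nx: "norm (x $ j) = r * C $ j" for j
  proof (cases "j \<in> s ` {1..k}")
    case True
    then obtain i where i: "i \<in> {1..k}" "j = s i" by blast
    then show ?thesis using xs[OF i(1)] Cs[OF i(1)] u(2)[OF i(1)] c(3)[OF i(1)] assms(4)
      by (simp add: abs_mult)
  qed (simp add: out)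
  note ns = norm_and_shape_eqI[OF C1 assms(4) nx]
  have "x $ j \<noteq> 0 \<longleftrightarrow> j \<in> s ` {1..k}" for j
  proof (cases "j \<in> s ` {1..k}")
    case True
    then obtain i where i: "i \<in> {1..k}" "j = s i" by blast
    then have "norm (x $ j) > 0" using nx[of j] Cs[OF i(1)] c(3)[OF i(1)] assms(4) by simp
    then show ?thesis using True by simp
  qed (simp add: out)
  then show ?A by (simp add: support_cell_def x_def)
  have "sgn (x $ s i) = u i" if "i \<in> {1..k}" for i
  proof -
    have "sgn (u i) = u i" using u(2)[OF that] by (simp add: sgn_div_norm)
    then show ?thesis
      using xs[OF that] c(3)[OF that] assms(4) by (simp add: sgn_scaleR sgn_mult)
  qed
  moreover have "shape x $ s i = c i" if "i \<in> {1..k}" for i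
    using ns(2) Cs[OF that] by simp
  ultimately have "(\<lambda>i\<in>{1..k}. sgn (x $ s i)) = u" "(\<lambda>i\<in>{1..k}. shape x $ s i) = c"
    using u(1) c(1) by (auto intro!: extensionalityI[of _ "{1..k}"])
  then show ?B by (simp add: cell_coords_def ns(1) flip: x_def)
qed

lemma cell_coords_in:
  assumes "inj_on s {1..k}" "1 \<le> k" "x \<in> support_cell (s ` {1..k})"
  shows "(\<lambda>i\<in>{1..k}. sgn (x $ s i)) \<in> topspace (torus k)" "norm x > 0"
    "(\<lambda>i\<in>{1..k}. shape x $ s i) \<in> topspace (positive_sphere k)"
    "cell_point k s (cell_coords k s x) = x"
proof -
  have ne: "x $ s i \<noteq> 0" if "i \<in> {1..k}" for i
    using assms(3) that by (auto simp: support_cell_def)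
  have "1 \<in> {1..k}" using assms(2) by simp
  then show x0: "norm x > 0" using ne by fastforce
  show "(\<lambda>i\<in>{1..k}. sgn (x $ s i)) \<in> topspace (torus k)"
    using ne by (auto simp: topspace_torus dist_norm norm_minus_commute zero_prod_def[symmetric] norm_sgn)
  have "(norm (shape x))\<^sup>2 = (\<Sum>i=1..k. (shape x $ s i)\<^sup>2)"
    by (rule power2_norm_vec[of _ _ "s ` {1..k}"])
      (use assms in \<open>auto simp: bij_betw_def support_cell_def shape_def\<close>)
  then show "(\<lambda>i\<in>{1..k}. shape x $ s i) \<in> topspace (positive_sphere k)"
    using norm_shape[of x] x0 ne by (simp add: topspace_positive_sphere) (simp add: shape_def)
  have "(norm x * shape x $ s i) *\<^sub>R sgn (x $ s i) = x $ s i" if "i \<in> {1..k}" for i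
    using ne[OF that] x0 by (simp add: shape_def sgn_div_norm)
  then show "cell_point k s (cell_coords k s x) = x"
    using assms by (auto simp: cell_point_def cell_coords_def vec_eq_iff support_cell_def)
qed

lemma continuous_map_torus_coords:
  "continuous_map (top_of_set (support_cell (s ` {1..k}))) (torus k)
    (\<lambda>x :: (real \<times> real) ^ 'n::finite. \<lambda>i\<in>{1..k}. sgn (x $ s i))"
  unfolding torus_def continuous_map_componentwise continuous_map_in_subtopology
proof (intro conjI ballI)
  let ?M = "support_cell (s ` {1..k}) :: ((real \<times> real) ^ 'n) set"
  fix i assume i: "i \<in> {1..k}"
  have ne: "x $ s i \<noteq> 0" if "x \<in> ?M" for x
    using that i by (auto simp: support_cell_def)
  have "continuous_on ?M (\<lambda>x. sgn (x $ s i))"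
    by (intro continuous_on_sgn continuous_intros) (use ne in auto)
  then show "continuous_map (top_of_set ?M) euclidean (\<lambda>x. (\<lambda>i\<in>{1..k}. sgn (x $ s i)) i)"
    using i by simp
  show "(\<lambda>x. (\<lambda>i\<in>{1..k}. sgn (x $ s i)) i) \<in> topspace (top_of_set ?M) \<rightarrow> sphere (0, 0) 1"
    using i ne by (auto simp: dist_norm norm_minus_commute zero_prod_def[symmetric] norm_sgn)
qed auto

lemma continuous_map_cell_coords:
  fixes s :: "nat \<Rightarrow> 'n::finite"
  assumes "inj_on s {1..k}" "1 \<le> k"
  shows "continuous_map (top_of_set (support_cell (s ` {1..k})))
    (prod_topology (torus k) (prod_topology (top_of_set {0::real<..}) (positive_sphere k))) (cell_coords k s)"
  unfolding cell_coords_def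
proof (intro continuous_map_pairedI continuous_map_torus_coords)
  let ?M = "support_cell (s ` {1..k}) :: ((real \<times> real) ^ 'n) set"
  note pos = cell_coords_in(2)[OF assms]
  show "continuous_map (top_of_set ?M) (top_of_set {0::real<..}) norm"
    using pos by (auto simp: continuous_map_in_subtopology intro!: continuous_intros)
  have "continuous_on ?M (\<lambda>x. shape x $ s i)" for i
    unfolding shape_def using pos by (auto intro!: continuous_intros)
  then show "continuous_map (top_of_set ?M) (positive_sphere k) (\<lambda>x. \<lambda>i\<in>{1..k}. shape x $ s i)"
    using cell_coords_in(3)[OF assms] unfolding positive_sphere_def
    by (auto simp: continuous_map_in_subtopology continuous_map_componentwise)
qed

lemma continuous_map_cell_point:
  fixes s :: "nat \<Rightarrow> 'n::finite"
  assumes "inj_on s {1..k}" "1 \<le> k"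
  shows "continuous_map (prod_topology (torus k) (prod_topology (top_of_set {0::real<..}) (positive_sphere k)))
    (top_of_set (support_cell (s ` {1..k}))) (cell_point k s)"
    (is "continuous_map ?Z _ _")
  unfolding continuous_map_in_subtopology
proof
  have u: "continuous_map ?Z euclidean (\<lambda>z. fst z i)"
    and c: "continuous_map ?Z euclidean (\<lambda>z. snd (snd z) i)" if "i \<in> {1..k}" for i
  proof -
    have "continuous_map (torus k) euclidean (\<lambda>u. u i)"
      unfolding torus_def
      by (rule continuous_map_into_fulltopology[OF continuous_map_product_projection[OF that]])
    from continuous_map_compose[OF continuous_map_fst this]
    show "continuous_map ?Z euclidean (\<lambda>z. fst z i)" by (simp add: o_def)
    have "continuous_map (positive_sphere k) euclidean (\<lambda>c. c i)"
      unfolding positive_sphere_def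
      by (rule continuous_map_from_subtopology[OF continuous_map_product_projection[OF that]])
    from continuous_map_compose[OF continuous_map_compose[OF continuous_map_snd continuous_map_snd] this]
    show "continuous_map ?Z euclidean (\<lambda>z. snd (snd z) i)" by (simp add: o_def)
  qed
  have "continuous_map ?Z (top_of_set {0::real<..}) (\<lambda>z. fst (snd z))"
    using continuous_map_compose[OF continuous_map_snd continuous_map_fst] by (simp add: o_def)
  then have r: "continuous_map ?Z euclidean (\<lambda>z. fst (snd z))"
    by (rule continuous_map_into_fulltopology)
  have "continuous_map ?Z euclidean (\<lambda>z. if j \<in> s ` {1..k}
      then (fst (snd z) * snd (snd z) (inv_into {1..k} s j)) *\<^sub>R fst z (inv_into {1..k} s j) else 0)" for j
  proof (cases "j \<in> s ` {1..k}")
    case True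
    then have "inv_into {1..k} s j \<in> {1..k}" by (rule inv_into_into)
    with True show ?thesis
      by (simp only: if_True) (intro continuous_map_scaleR continuous_map_real_mult r u c)
  qed simp
  then show "continuous_map ?Z euclidean (cell_point k s)"
    unfolding cell_point_def case_prod_beta by (rule continuous_map_vec_lambda)
  show "cell_point k s \<in> topspace ?Z \<rightarrow> support_cell (s ` {1..k})"
    using cell_point_coords(1)[OF assms] by auto
qed

lemma homeomorphic_support_cell:
  fixes s :: "nat \<Rightarrow> 'n::finite"
  assumes "inj_on s {1..k}" "1 \<le> k"
  shows "top_of_set (support_cell (s ` {1..k}) :: ((real \<times> real) ^ 'n) set) homeomorphic_space
    prod_topology (torus k) (prod_topology (top_of_set {0::real<..}) (positive_sphere k))"
proof -
  have "homeomorphic_maps (top_of_set (support_cell (s ` {1..k}) :: ((real \<times> real) ^ 'n) set))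
      (prod_topology (torus k) (prod_topology (top_of_set {0::real<..}) (positive_sphere k)))
      (cell_coords k s) (cell_point k s)"
    unfolding homeomorphic_maps_def
    using continuous_map_cell_coords[OF assms] continuous_map_cell_point[OF assms]
      cell_coords_in(4)[OF assms] cell_point_coords(2)[OF assms] by auto
  then show ?thesis unfolding homeomorphic_space_def by blast
qed

text \<open>
The coordinates of the cell restrict to the fibre, where the third one is constant.
\<close>

lemma homeomorphic_shape_fibre:
  fixes s :: "nat \<Rightarrow> 'n::finite" and y :: "(real \<times> real) ^ 'n"
  assumes "inj_on s {1..k}" "1 \<le> k" and y: "y \<in> support_cell (s ` {1..k})"
  shows "top_of_set {x :: (real \<times> real) ^ 'n. shape x = shape y} homeomorphic_space
    prod_topology (torus k) (top_of_set {0::real<..})"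
proof -
  let ?M = "support_cell (s ` {1..k}) :: ((real \<times> real) ^ 'n) set"
  let ?L = "{x :: (real \<times> real) ^ 'n. shape x = shape y}"
  let ?Z = "prod_topology (torus k) (top_of_set {0::real<..})"
  define c where "c = (\<lambda>i\<in>{1..k}. shape y $ s i)"
  define f where "f x = (fst (cell_coords k s x), fst (snd (cell_coords k s x)))" for x :: "(real \<times> real) ^ 'n"
  define g where "g = (\<lambda>z. cell_point k s (fst z, snd z, c))"
  have J: "s ` {1..k} \<noteq> {}" using assms(2) by auto
  have sub: "?L \<subseteq> ?M" using shape_eq_support_cell[OF y J] by blast
  have c: "c \<in> topspace (positive_sphere k)"
    unfolding c_def by (rule cell_coords_in(3)[OF assms])
  have cx: "cell_coords k s x = (fst (f x), snd (f x), c)" if "x \<in> ?L" for x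
    using that by (simp add: f_def cell_coords_def c_def)
  have "continuous_map (top_of_set ?L)
      (prod_topology (torus k) (prod_topology (top_of_set {0::real<..}) (positive_sphere k))) (cell_coords k s)"
    by (rule continuous_map_from_subtopology_mono[OF continuous_map_cell_coords[OF assms(1,2)] sub])
  then have "continuous_map (top_of_set ?L) ?Z f"
    unfolding f_def by (auto simp: continuous_map_pairwise o_def)
  moreover have "continuous_map ?Z (top_of_set ?M) g"
  proof -
    have "continuous_map ?Z (prod_topology (torus k) (prod_topology (top_of_set {0::real<..}) (positive_sphere k)))
        (\<lambda>z. (fst z, snd z, c))"
      using c by (intro continuous_map_pairedI continuous_map_fst continuous_map_snd) simp
    from continuous_map_compose[OF this continuous_map_cell_point[OF assms(1,2)]]
    show ?thesis by (simp add: g_def o_def)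
  qed
  moreover have gz: "cell_coords k s (g z) = (fst z, snd z, c)" "g z \<in> ?M" if "z \<in> topspace ?Z" for z
    using that cell_point_coords[OF assms(1,2) _ _ c, of "fst z" "snd z"] by (auto simp: g_def)
  moreover have "g z \<in> ?L" if "z \<in> topspace ?Z" for z
  proof -
    have "shape (g z) $ j = shape y $ j" for j
    proof (cases "j \<in> s ` {1..k}")
      case True
      then obtain i where i: "i \<in> {1..k}" "j = s i" by blast
      have "(\<lambda>i\<in>{1..k}. shape (g z) $ s i) i = c i"
        using gz(1)[OF that] by (simp add: cell_coords_def)
      then show ?thesis using i by (simp add: c_def)
    next
      case False
      then have "g z $ j = 0" "y $ j = 0" using gz(2)[OF that] y by (auto simp: support_cell_def)
      then show ?thesis by (simp add: shape_def)
    qed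
    then show ?thesis by (simp add: vec_eq_iff)
  qed
  moreover have "g (f x) = x" if "x \<in> ?L" for x
    unfolding g_def cx[OF that, symmetric] using cell_coords_in(4)[OF assms(1,2)] that sub by blast
  moreover have "f (g z) = z" if "z \<in> topspace ?Z" for z
    using gz(1)[OF that] by (simp add: f_def)
  ultimately have "homeomorphic_maps (top_of_set ?L) ?Z f g"
    unfolding homeomorphic_maps_def by (auto simp: continuous_map_in_subtopology)
  then show ?thesis unfolding homeomorphic_space_def by blast
qed

section \<open>Cells and leaves in terms of the shape\<close>

text \<open>
From here on \<open>J\<close> is the set of coordinate pairs that do not vanish on the cell. The numbering \<open>e\<close> and
the permutation \<open>\<sigma>\<close> enter only through \<open>J\<close>, because \<open>e \<circ> \<sigma>\<close> is a bijection.
\<close>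

context
  fixes e :: "nat \<Rightarrow> 'n::finite" and k :: nat and \<sigma> :: "nat \<Rightarrow> nat" and J :: "'n set"
  assumes e: "bij_betw e {1..CARD('n)} UNIV" and k: "1 \<le> k" "k \<le> CARD('n)"
    and \<sigma>: "\<sigma> permutes {1..CARD('n)}"
  defines "J \<equiv> (\<lambda>i. e (\<sigma> i)) ` {1..k}"
begin

lemma bij_index: "bij_betw (\<lambda>i. e (\<sigma> i)) {1..CARD('n)} UNIV"
  using bij_betw_trans[OF permutes_imp_bij[OF \<sigma>] e] by (simp add: o_def)

lemma inj_index: "inj_on (\<lambda>i. e (\<sigma> i)) {1..k}"
  using bij_index k(2) by (auto simp: bij_betw_def intro: inj_on_subset)

lemma card_index: "card J = k"
  unfolding J_def using card_image[OF inj_index] by simp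

lemma outside_index: "(\<lambda>i. e (\<sigma> i)) ` {k<..CARD('n)} = - J"
proof -
  have "{k<..CARD('n)} = {1..CARD('n)} - {1..k}" using k by auto
  then show ?thesis
    using bij_index k unfolding J_def bij_betw_def
    by (metis Compl_eq_Diff_UNIV atLeastatMost_subset_iff image_set_diff inj_on_image_set_diff order_refl Diff_subset)
qed

lemma cell_eq: "cell e k \<sigma> = support_cell J"
proof -
  have "x \<in> cell e k \<sigma> \<longleftrightarrow> (\<forall>j\<in>J. x $ j \<noteq> 0) \<and> (\<forall>j\<in>-J. x $ j = 0)" for x
    unfolding outside_index[symmetric] unfolding J_def by (auto simp: cell_def zero_prod_def)
  then show ?thesis by (auto simp: support_cell_def)
qed

lemma leaf_params_iff:
  "C \<in> leaf_params e k \<sigma> \<longleftrightarrow> norm C = 1 \<and> (\<forall>j\<in>J. C $ j > 0) \<and> (\<forall>j\<in>-J. C $ j = 0)"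
proof -
  have "C \<in> leaf_params e k \<sigma> \<longleftrightarrow>
      (\<Sum>i=1..k. (C $ e (\<sigma> i))\<^sup>2) = 1 \<and> (\<forall>j\<in>J. C $ j > 0) \<and> (\<forall>j\<in>-J. C $ j = 0)"
    unfolding outside_index[symmetric] unfolding J_def by (auto simp: leaf_params_def)
  moreover have "(\<Sum>i=1..k. (C $ e (\<sigma> i))\<^sup>2) = (norm C)\<^sup>2" if "\<forall>j\<in>-J. C $ j = 0"
    using that inj_index unfolding J_def by (intro power2_norm_vec[symmetric]) (auto simp: bij_betw_def)
  moreover have "(norm C)\<^sup>2 = 1 \<longleftrightarrow> norm C = 1"
    by (metis abs_norm_cancel abs_square_eq_1)
  ultimately show ?thesis by metis
qed

text \<open>
Every parameter is the shape of a point of the cell, for instance of the one with radii \<open>C\<close> and all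
angles zero.
\<close>

lemma leaf_params_eq: "leaf_params e k \<sigma> = shape ` (support_cell J :: ((real \<times> real) ^ 'n) set)"
proof (intro equalityI subsetI)
  fix C assume "C \<in> leaf_params e k \<sigma>"
  then have C: "norm C = 1" "\<forall>j\<in>J. C $ j > 0" "\<forall>j\<in>-J. C $ j = 0" by (auto simp: leaf_params_iff)
  let ?x = "(\<chi> j. (C $ j, 0)) :: (real \<times> real) ^ 'n"
  have "C $ j \<ge> 0" for j using C by (cases "j \<in> J") auto
  then have "shape ?x = C"
    unfolding shape_eq_iff[OF C(1)] by (intro exI[of _ 1]) (simp add: norm_Pair)
  moreover have "?x \<in> support_cell J"
    using C by (auto simp: support_cell_def zero_prod_def)
  ultimately show "C \<in> shape ` (support_cell J :: ((real \<times> real) ^ 'n) set)"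
    by (metis image_eqI)
next
  fix C assume "C \<in> shape ` (support_cell J :: ((real \<times> real) ^ 'n) set)"
  then obtain x :: "(real \<times> real) ^ 'n" where x: "x \<in> support_cell J" "C = shape x" by blast
  have "e (\<sigma> 1) \<in> J" unfolding J_def using k(1) by auto
  then have "x \<noteq> 0" using x by (auto simp: support_cell_def)
  then show "C \<in> leaf_params e k \<sigma>"
    using x by (auto simp: leaf_params_iff norm_shape) (auto simp: support_cell_def shape_def)
qed

text \<open>
The pairwise proportionality of the radii gives a common factor by comparison with one fixed index
\<open>i \<in> J\<close>, at which both radii are positive.
\<close>

lemma leaf_eq:
  assumes "C \<in> leaf_params e k \<sigma>"
  shows "leaf e k \<sigma> C = {x. shape x = C}"
proof -
  have C: "norm C = 1" "\<And>j. j \<in> J \<Longrightarrow> C $ j > 0" "\<And>j. j \<notin> J \<Longrightarrow> C $ j = 0"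
    using assms by (auto simp: leaf_params_iff)
  have mem: "x \<in> leaf e k \<sigma> C \<longleftrightarrow>
      x \<in> support_cell J \<and> (\<forall>i\<in>J. \<forall>j\<in>J. C $ j * norm (x $ i) = C $ i * norm (x $ j))" for x
    by (simp add: leaf_def cell_eq) (simp add: J_def)
  have "e (\<sigma> 1) \<in> J" unfolding J_def using k(1) by auto
  then obtain i where i: "i \<in> J" by blast
  show ?thesis
  proof (intro equalityI subsetI)
    fix x assume x: "x \<in> leaf e k \<sigma> C"
    have xi: "norm (x $ i) > 0" using x i mem by (auto simp: support_cell_def)
    have nx: "norm (x $ j) = norm (x $ i) / C $ i * C $ j" for j
    proof (cases "j \<in> J")
      case True
      then have "C $ j * norm (x $ i) = C $ i * norm (x $ j)" using x i mem by blast
      then show ?thesis using C(2)[OF i] by (simp add: field_simps)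
    next
      case False
      then show ?thesis using x mem C(3) by (auto simp: support_cell_def)
    qed
    have "shape x = C"
      unfolding shape_eq_iff[OF C(1)]
      by (intro exI[of _ "norm (x $ i) / C $ i"] conjI allI nx divide_pos_pos xi C(2) i)
    then show "x \<in> {x. shape x = C}" by simp
  next
    fix x :: "(real \<times> real) ^ 'n" assume "x \<in> {x. shape x = C}"
    then obtain l where l: "l > 0" "\<And>j. norm (x $ j) = l * C $ j"
      using shape_eq_iff[OF C(1)] by auto
    have "x $ j \<noteq> 0 \<longleftrightarrow> j \<in> J" for j
      using l(2)[of j] l(1) C(2,3)[of j] by (cases "j \<in> J") auto
    then show "x \<in> leaf e k \<sigma> C" unfolding mem by (simp add: support_cell_def l(2))
  qed
qed

end

theorem theorem2p3:
  fixes e :: "nat \<Rightarrow> 'n::finite" and k :: nat and \<sigma> :: "nat \<Rightarrow> nat"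
  assumes "bij_betw e {1..CARD('n)} UNIV"
    and "1 \<le> k" and "k \<le> CARD('n)"
    and "\<sigma> \<in> shuffle_perms k CARD('n)"
  shows "smooth_foliation (k + 1) (cell e k \<sigma>) (leaf e k \<sigma> ` leaf_params e k \<sigma>)
    \<and> cell e k \<sigma> = (\<Union>C\<in>leaf_params e k \<sigma>. leaf e k \<sigma> C)
    \<and> disjoint_family_on (leaf e k \<sigma>) (leaf_params e k \<sigma>)
    \<and> (\<forall>C\<in>leaf_params e k \<sigma>.
          smooth_submanifold (k + 1) (leaf e k \<sigma> C)
        \<and> flow_invariant e (leaf e k \<sigma> C)
        \<and> top_of_set (leaf e k \<sigma> C) homeomorphic_space
            prod_topology (torus k) (top_of_set {0::real<..})
        \<and> minimal_invariant_manifold e (leaf e k \<sigma> C))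
    \<and> top_of_set (cell e k \<sigma>) homeomorphic_space
        prod_topology (torus k) (prod_topology (top_of_set {0::real<..}) (positive_sphere k))"
proof -
  have \<sigma>: "\<sigma> permutes {1..CARD('n)}" using assms(4) by (simp add: shuffle_perms_def)
  define J where "J = (\<lambda>i. e (\<sigma> i)) ` {1..k}"
  note index = assms(1-3) \<sigma>
  have J: "J \<noteq> {}" using assms(2) by (auto simp: J_def)
  have card: "card J = k" unfolding J_def by (rule card_index[OF index])
  have cell: "cell e k \<sigma> = support_cell J" unfolding J_def by (rule cell_eq[OF index])
  have params: "leaf_params e k \<sigma> = shape ` (support_cell J :: ((real \<times> real) ^ 'n) set)"
    unfolding J_def by (rule leaf_params_eq[OF index])
  have leaf: "leaf e k \<sigma> C = {x. shape x = C}" if "C \<in> leaf_params e k \<sigma>" for C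
    by (rule leaf_eq[OF index that])
  have leaves: "leaf e k \<sigma> ` leaf_params e k \<sigma> = (\<lambda>C. {x. shape x = C}) ` leaf_params e k \<sigma>"
    by (rule image_cong[OF refl leaf])
  have fol: "smooth_foliation (k + 1) (cell e k \<sigma>) (leaf e k \<sigma> ` leaf_params e k \<sigma>)"
    using smooth_foliation_shape_fibres[OF J] unfolding leaves unfolding params cell card .
  moreover have "cell e k \<sigma> = (\<Union>C\<in>leaf_params e k \<sigma>. leaf e k \<sigma> C)"
    using fol by (simp add: smooth_foliation_def)
  moreover have "disjoint_family_on (leaf e k \<sigma>) (leaf_params e k \<sigma>)"
    by (auto simp: disjoint_family_on_def leaf)
  moreover have "smooth_submanifold (k + 1) (leaf e k \<sigma> C) \<and> flow_invariant e (leaf e k \<sigma> C)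
      \<and> top_of_set (leaf e k \<sigma> C) homeomorphic_space prod_topology (torus k) (top_of_set {0::real<..})
      \<and> minimal_invariant_manifold e (leaf e k \<sigma> C)" if C: "C \<in> leaf_params e k \<sigma>" for C
  proof -
    obtain y :: "(real \<times> real) ^ 'n" where y: "y \<in> support_cell J" "C = shape y"
      using C params by blast
    show ?thesis
      unfolding leaf[OF C] unfolding y(2)
      using smooth_submanifold_shape_fibre[OF y(1) J] flow_invariant_shape_fibre
        minimal_invariant_manifold_shape_fibre[OF assms(1) y(1) J]
        homeomorphic_shape_fibre[OF inj_index[OF index] assms(2) y(1)[unfolded J_def]]
      unfolding card by blast
  qed
  moreover have "top_of_set (cell e k \<sigma>) homeomorphic_space
      prod_topology (torus k) (prod_topology (top_of_set {0::real<..}) (positive_sphere k))"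
    unfolding cell J_def by (rule homeomorphic_support_cell[OF inj_index[OF index] assms(2)])
  ultimately show ?thesis by blast
qed

end
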